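(* For any hom-involutive symmetric monoidal category $\mathsf C$, the cofree ICD-category $\mathsf{Cof}(\mathsf C)$ is an ICD-category, where: (i) the involution $\phi\mapsto\overline\phi$ is the one of $\mathsf C$; (ii) the copy and delete morphisms on each object are given by the comonoid structure.
   Context: A hom-involutive symmetric monoidal category is a symmetric monoidal category $(\mathsf C,\odot,I)$ with a strict symmetric monoidal endofunctor $\phi\mapsto\overline\phi$ (the involution) that is the identity on objects and whose square is the identity functor. An ICD-category is such a $\mathsf C$ in which every object $A$ comes with morphisms $\mathrm{copy}_A\colon A\to A\odot A$ and $\mathrm{del}_A\colon A\to I$ such that (suppressing coherence isomorphisms): (1) $(\mathrm{copy}_A\odot\mathrm{id})\mathrm{copy}_A=(\mathrm{id}\odot\mathrm{copy}_A)\mathrm{copy}_A$ and $(\mathrm{del}_A\odot\mathrm{id})\mathrm{copy}_A=\mathrm{id}_A=(\mathrm{id}\odot\mathrm{del}_A)\mathrm{copy}_A$; (2) $\overline{\mathrm{copy}_A}=\mathrm{swap}_{A,A}\,\mathrm{copy}_A$ and $\overline{\mathrm{del}_A}=\mathrm{del}_A$; (3) $\mathrm{copy}_{A\odot B}=(\mathrm{id}_A\odot\mathrm{swap}_{A,B}\odot\mathrm{id}_B)(\mathrm{copy}_A\odot\mathrm{copy}_B)$, $\mathrm{del}_{A\odot B}=\mathrm{del}_A\odot\mathrm{del}_B$, $\mathrm{del}_I=\mathrm{id}_I$, $\mathrm{copy}_I=\mathrm{id}_I$ (up to $I\cong I\odot I$). An involutive comonoid in $\mathsf C$ is a (coassociative,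 counital) comonoid $(A,\mu_A,\epsilon_A)$ with $\overline{\mu_A}=\mathrm{swap}_{A,A}\,\mu_A$ and $\overline{\epsilon_A}=\epsilon_A$. The cofree ICD-category $\mathsf{Cof}(\mathsf C)$ is the category whose objects are involutive comonoids in $\mathsf C$ and whose morphisms $(A,\mu_A,\epsilon_A)\to(B,\mu_B,\epsilon_B)$ are all morphisms $A\to B$ of $\mathsf C$; its symmetric monoidal structure lifts that of $\mathsf C$ via $\mu_{A\odot B}:=(\mathrm{id}_A\odot\mathrm{swap}_{A,B}\odot\mathrm{id}_B)(\mu_A\odot\mu_B)$, $\epsilon_{A\odot B}:=\epsilon_A\odot\epsilon_B$, with unit $(I,\mathrm{id}_I,\mathrm{id}_I)$. *)

theory Defs
  imports Main
begin

section \<open>Symmetric monoidal categories\<close>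

text \<open>
  \<open>Hom A B\<close> is meaningful for objects only and is normalised to be empty elsewhere; distinct
  hom-sets are disjoint, so that every morphism determines its source and target and the operations
  on morphisms need no object indices. \<open>f \<cdot> g\<close> is \<open>f\<close> after \<open>g\<close>. The tensor
  product is written \<open>\<odot>\<close> on objects and \<open>\<otimes>\<close> on morphisms.
\<close>

record ('o, 'm) cat =
  Objects :: "'o set"  (\<open>Ob\<index>\<close>)
  Homset :: "'o \<Rightarrow> 'o \<Rightarrow> 'm set"  (\<open>Hom\<index>\<close>)
  Id :: "'o \<Rightarrow> 'm"  (\<open>\<one>\<index>\<close>)
  Comp :: "'m \<Rightarrow> 'm \<Rightarrow> 'm"  (infixr \<open>\<cdot>\<index>\<close> 65)

record ('o, 'm) smc = "('o, 'm) cat" +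
  Unit :: 'o  (\<open>\<I>\<index>\<close>)
  TensorOb :: "'o \<Rightarrow> 'o \<Rightarrow> 'o"  (infixl \<open>\<odot>\<index>\<close> 75)
  TensorHom :: "'m \<Rightarrow> 'm \<Rightarrow> 'm"  (infixl \<open>\<otimes>\<index>\<close> 75)
  Assoc :: "'o \<Rightarrow> 'o \<Rightarrow> 'o \<Rightarrow> 'm"  (\<open>\<alpha>\<index>\<close>)
  LUnit :: "'o \<Rightarrow> 'm"  (\<open>\<l>\<index>\<close>)
  RUnit :: "'o \<Rightarrow> 'm"  (\<open>\<r>\<index>\<close>)
  Swap :: "'o \<Rightarrow> 'o \<Rightarrow> 'm"  (\<open>\<sigma>\<index>\<close>)

locale category =
  fixes C :: "('o, 'm, 'x) cat_scheme" (structure)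
  assumes hom_ob: "f \<in> Hom A B \<Longrightarrow> A \<in> Ob \<and> B \<in> Ob"
    and hom_disjoint: "f \<in> Hom A B \<Longrightarrow> f \<in> Hom A' B' \<Longrightarrow> A = A' \<and> B = B'"
    and id_hom: "A \<in> Ob \<Longrightarrow> \<one> A \<in> Hom A A"
    and comp_hom: "f \<in> Hom A B \<Longrightarrow> g \<in> Hom B D \<Longrightarrow> g \<cdot> f \<in> Hom A D"
    and id_left: "f \<in> Hom A B \<Longrightarrow> \<one> B \<cdot> f = f"
    and id_right: "f \<in> Hom A B \<Longrightarrow> f \<cdot> \<one> A = f"
    and comp_assoc: "f \<in> Hom A B \<Longrightarrow> g \<in> Hom B D \<Longrightarrow> h \<in> Hom D E \<Longrightarrow>
      (h \<cdot> g) \<cdot> f = h \<cdot> (g \<cdot> f)"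

definition inverse_morphisms :: "('o, 'm, 'x) cat_scheme \<Rightarrow> 'm \<Rightarrow> 'm \<Rightarrow> bool" where
  "inverse_morphisms C f g \<longleftrightarrow>
    (\<exists>A B. f \<in> Hom\<^bsub>C\<^esub> A B \<and> g \<in> Hom\<^bsub>C\<^esub> B A \<and>
      g \<cdot>\<^bsub>C\<^esub> f = \<one>\<^bsub>C\<^esub> A \<and> f \<cdot>\<^bsub>C\<^esub> g = \<one>\<^bsub>C\<^esub> B)"

definition is_iso :: "('o, 'm, 'x) cat_scheme \<Rightarrow> 'm \<Rightarrow> bool" where
  "is_iso C f \<longleftrightarrow> (\<exists>g. inverse_morphisms C f g)"

definition inverse_of :: "('o, 'm, 'x) cat_scheme \<Rightarrow> 'm \<Rightarrow> 'm" where
  "inverse_of C f = (THE g. inverse_morphisms C f g)"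

locale symmetric_monoidal_category = category C
  for C :: "('o, 'm, 'x) smc_scheme" (structure) +
  assumes unit_ob: "\<I> \<in> Ob"
    and tensor_ob: "A \<in> Ob \<Longrightarrow> B \<in> Ob \<Longrightarrow> A \<odot> B \<in> Ob"
    and tensor_hom: "f \<in> Hom A A' \<Longrightarrow> g \<in> Hom B B' \<Longrightarrow> f \<otimes> g \<in> Hom (A \<odot> B) (A' \<odot> B')"
    and tensor_id: "A \<in> Ob \<Longrightarrow> B \<in> Ob \<Longrightarrow> \<one> A \<otimes> \<one> B = \<one> (A \<odot> B)"
    and tensor_comp: "f \<in> Hom A A' \<Longrightarrow> f' \<in> Hom A' A'' \<Longrightarrow> g \<in> Hom B B' \<Longrightarrow> g' \<in> Hom B' B'' \<Longrightarrow>
      (f' \<cdot> f) \<otimes> (g' \<cdot> g) = (f' \<otimes> g') \<cdot> (f \<otimes> g)"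
    and assoc_hom: "A \<in> Ob \<Longrightarrow> B \<in> Ob \<Longrightarrow> D \<in> Ob \<Longrightarrow>
      \<alpha> A B D \<in> Hom ((A \<odot> B) \<odot> D) (A \<odot> (B \<odot> D))"
    and assoc_iso: "A \<in> Ob \<Longrightarrow> B \<in> Ob \<Longrightarrow> D \<in> Ob \<Longrightarrow> is_iso C (\<alpha> A B D)"
    and assoc_natural: "f \<in> Hom A A' \<Longrightarrow> g \<in> Hom B B' \<Longrightarrow> h \<in> Hom D D' \<Longrightarrow>
      \<alpha> A' B' D' \<cdot> ((f \<otimes> g) \<otimes> h) = (f \<otimes> (g \<otimes> h)) \<cdot> \<alpha> A B D"
    and lunit_hom: "A \<in> Ob \<Longrightarrow> \<l> A \<in> Hom (\<I> \<odot> A) A"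
    and lunit_iso: "A \<in> Ob \<Longrightarrow> is_iso C (\<l> A)"
    and lunit_natural: "f \<in> Hom A A' \<Longrightarrow> \<l> A' \<cdot> (\<one> \<I> \<otimes> f) = f \<cdot> \<l> A"
    and runit_hom: "A \<in> Ob \<Longrightarrow> \<r> A \<in> Hom (A \<odot> \<I>) A"
    and runit_iso: "A \<in> Ob \<Longrightarrow> is_iso C (\<r> A)"
    and runit_natural: "f \<in> Hom A A' \<Longrightarrow> \<r> A' \<cdot> (f \<otimes> \<one> \<I>) = f \<cdot> \<r> A"
    and swap_hom: "A \<in> Ob \<Longrightarrow> B \<in> Ob \<Longrightarrow> \<sigma> A B \<in> Hom (A \<odot> B) (B \<odot> A)"
    and swap_swap: "A \<in> Ob \<Longrightarrow> B \<in> Ob \<Longrightarrow> \<sigma> B A \<cdot> \<sigma> A B = \<one> (A \<odot> B)"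
    and swap_natural: "f \<in> Hom A A' \<Longrightarrow> g \<in> Hom B B' \<Longrightarrow>
      \<sigma> A' B' \<cdot> (f \<otimes> g) = (g \<otimes> f) \<cdot> \<sigma> A B"
    and pentagon: "A \<in> Ob \<Longrightarrow> B \<in> Ob \<Longrightarrow> D \<in> Ob \<Longrightarrow> E \<in> Ob \<Longrightarrow>
      \<alpha> A B (D \<odot> E) \<cdot> \<alpha> (A \<odot> B) D E =
      (\<one> A \<otimes> \<alpha> B D E) \<cdot> \<alpha> A (B \<odot> D) E \<cdot> (\<alpha> A B D \<otimes> \<one> E)"
    and triangle: "A \<in> Ob \<Longrightarrow> B \<in> Ob \<Longrightarrow> (\<one> A \<otimes> \<l> B) \<cdot> \<alpha> A \<I> B = \<r> A \<otimes> \<one> B"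
    and hexagon: "A \<in> Ob \<Longrightarrow> B \<in> Ob \<Longrightarrow> D \<in> Ob \<Longrightarrow>
      \<alpha> B D A \<cdot> \<sigma> A (B \<odot> D) \<cdot> \<alpha> A B D =
      (\<one> B \<otimes> \<sigma> A D) \<cdot> \<alpha> B A D \<cdot> (\<sigma> A B \<otimes> \<one> D)"

text \<open>\<open>Fo\<close> and \<open>Fm\<close> are the actions on objects and on morphisms.\<close>

locale strict_symmetric_monoidal_functor =
  C: symmetric_monoidal_category C + D: symmetric_monoidal_category D
  for C :: "('o, 'm, 'x) smc_scheme" and D :: "('p, 'n, 'y) smc_scheme" +
  fixes Fo :: "'o \<Rightarrow> 'p" and Fm :: "'m \<Rightarrow> 'n"
  assumes map_ob: "A \<in> Ob\<^bsub>C\<^esub> \<Longrightarrow> Fo A \<in> Ob\<^bsub>D\<^esub>"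
    and map_hom: "f \<in> Hom\<^bsub>C\<^esub> A B \<Longrightarrow> Fm f \<in> Hom\<^bsub>D\<^esub> (Fo A) (Fo B)"
    and map_id: "A \<in> Ob\<^bsub>C\<^esub> \<Longrightarrow> Fm (\<one>\<^bsub>C\<^esub> A) = \<one>\<^bsub>D\<^esub> (Fo A)"
    and map_comp: "f \<in> Hom\<^bsub>C\<^esub> A B \<Longrightarrow> g \<in> Hom\<^bsub>C\<^esub> B E \<Longrightarrow>
      Fm (g \<cdot>\<^bsub>C\<^esub> f) = Fm g \<cdot>\<^bsub>D\<^esub> Fm f"
    and map_unit: "Fo \<I>\<^bsub>C\<^esub> = \<I>\<^bsub>D\<^esub>"
    and map_tensor_ob: "A \<in> Ob\<^bsub>C\<^esub> \<Longrightarrow> B \<in> Ob\<^bsub>C\<^esub> \<Longrightarrow> Fo (A \<odot>\<^bsub>C\<^esub> B) = Fo A \<odot>\<^bsub>D\<^esub> Fo B"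
    and map_tensor_hom: "f \<in> Hom\<^bsub>C\<^esub> A A' \<Longrightarrow> g \<in> Hom\<^bsub>C\<^esub> B B' \<Longrightarrow>
      Fm (f \<otimes>\<^bsub>C\<^esub> g) = Fm f \<otimes>\<^bsub>D\<^esub> Fm g"
    and map_assoc: "A \<in> Ob\<^bsub>C\<^esub> \<Longrightarrow> B \<in> Ob\<^bsub>C\<^esub> \<Longrightarrow> E \<in> Ob\<^bsub>C\<^esub> \<Longrightarrow>
      Fm (\<alpha>\<^bsub>C\<^esub> A B E) = \<alpha>\<^bsub>D\<^esub> (Fo A) (Fo B) (Fo E)"
    and map_lunit: "A \<in> Ob\<^bsub>C\<^esub> \<Longrightarrow> Fm (\<l>\<^bsub>C\<^esub> A) = \<l>\<^bsub>D\<^esub> (Fo A)"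
    and map_runit: "A \<in> Ob\<^bsub>C\<^esub> \<Longrightarrow> Fm (\<r>\<^bsub>C\<^esub> A) = \<r>\<^bsub>D\<^esub> (Fo A)"
    and map_swap: "A \<in> Ob\<^bsub>C\<^esub> \<Longrightarrow> B \<in> Ob\<^bsub>C\<^esub> \<Longrightarrow> Fm (\<sigma>\<^bsub>C\<^esub> A B) = \<sigma>\<^bsub>D\<^esub> (Fo A) (Fo B)"

locale hom_involutive_smc = symmetric_monoidal_category C
  for C :: "('o, 'm, 'x) smc_scheme" (structure) +
  fixes bar :: "'m \<Rightarrow> 'm"
  assumes bar_functor: "strict_symmetric_monoidal_functor C C (\<lambda>A. A) bar"
    and bar_bar: "f \<in> Hom A B \<Longrightarrow> bar (bar f) = f"


section \<open>Comonoids and ICD-categories\<close>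

context
  fixes C :: "('o, 'm, 'x) smc_scheme" (structure)
begin

text \<open>
  The middle-four interchange \<open>id \<odot> swap \<odot> id\<close> with its coherence isomorphisms, as a morphism
  \<open>(A \<odot> A') \<odot> (B \<odot> B') \<rightarrow> (A \<odot> B) \<odot> (A' \<odot> B')\<close> that swaps \<open>A'\<close> and \<open>B\<close>.
\<close>

definition interchange :: "'o \<Rightarrow> 'o \<Rightarrow> 'o \<Rightarrow> 'o \<Rightarrow> 'm" where
  "interchange A A' B B' =
    inverse_of C (\<alpha> A B (A' \<odot> B'))
    \<cdot> (\<one> A \<otimes> (\<alpha> B A' B' \<cdot> (\<sigma> A' B \<otimes> \<one> B') \<cdot> inverse_of C (\<alpha> A' B B')))
    \<cdot> \<alpha> A A' (B \<odot> B')"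

definition tensor_copy :: "'o \<Rightarrow> 'm \<Rightarrow> 'o \<Rightarrow> 'm \<Rightarrow> 'm" where
  "tensor_copy A \<mu> B \<nu> = interchange A A B B \<cdot> (\<mu> \<otimes> \<nu>)"

definition tensor_del :: "'m \<Rightarrow> 'm \<Rightarrow> 'm" where
  "tensor_del \<epsilon> \<delta> = \<l> \<I> \<cdot> (\<epsilon> \<otimes> \<delta>)"

definition unit_copy :: 'm where
  "unit_copy = inverse_of C (\<l> \<I>)"

definition comonoid :: "'o \<Rightarrow> 'm \<Rightarrow> 'm \<Rightarrow> bool" where
  "comonoid A \<mu> \<epsilon> \<longleftrightarrow>
    A \<in> Ob \<and> \<mu> \<in> Hom A (A \<odot> A) \<and> \<epsilon> \<in> Hom A \<I> \<and>
    \<alpha> A A A \<cdot> (\<mu> \<otimes> \<one> A) \<cdot> \<mu> = (\<one> A \<otimes> \<mu>) \<cdot> \<mu> \<and>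
    \<l> A \<cdot> (\<epsilon> \<otimes> \<one> A) \<cdot> \<mu> = \<one> A \<and>
    \<r> A \<cdot> (\<one> A \<otimes> \<epsilon>) \<cdot> \<mu> = \<one> A"

definition involutive_comonoid :: "('m \<Rightarrow> 'm) \<Rightarrow> 'o \<Rightarrow> 'm \<Rightarrow> 'm \<Rightarrow> bool" where
  "involutive_comonoid bar A \<mu> \<epsilon> \<longleftrightarrow>
    comonoid A \<mu> \<epsilon> \<and> bar \<mu> = \<sigma> A A \<cdot> \<mu> \<and> bar \<epsilon> = \<epsilon>"

end

locale icd_category = hom_involutive_smc C bar
  for C :: "('o, 'm, 'x) smc_scheme" (structure) and bar :: "'m \<Rightarrow> 'm" +
  fixes copy :: "'o \<Rightarrow> 'm" and del :: "'o \<Rightarrow> 'm"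
  assumes copy_del_comonoid: "A \<in> Ob \<Longrightarrow> comonoid C A (copy A) (del A)"
    and bar_copy: "A \<in> Ob \<Longrightarrow> bar (copy A) = \<sigma> A A \<cdot> copy A"
    and bar_del: "A \<in> Ob \<Longrightarrow> bar (del A) = del A"
    and copy_tensor: "A \<in> Ob \<Longrightarrow> B \<in> Ob \<Longrightarrow> copy (A \<odot> B) = tensor_copy C A (copy A) B (copy B)"
    and del_tensor: "A \<in> Ob \<Longrightarrow> B \<in> Ob \<Longrightarrow> del (A \<odot> B) = tensor_del C (del A) (del B)"
    and del_unit: "del \<I> = \<one> \<I>"
    and copy_unit: "copy \<I> = unit_copy C"


section \<open>The cofree ICD-category\<close>

text \<open>
  The same morphism of \<open>C\<close> occurs in many hom-sets of \<open>Cof(C)\<close>, so it is tagged with its source and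
  target comonoids in order to keep the hom-sets disjoint: a morphism is a triple \<open>(X, f, Y)\<close>.
\<close>

type_synonym ('o, 'm) cof_ob = "'o \<times> 'm \<times> 'm"
type_synonym ('o, 'm) cof_hom = "('o, 'm) cof_ob \<times> 'm \<times> ('o, 'm) cof_ob"

abbreviation carrier_of :: "('o, 'm) cof_ob \<Rightarrow> 'o" where
  "carrier_of X \<equiv> fst X"

abbreviation comult_of :: "('o, 'm) cof_ob \<Rightarrow> 'm" where
  "comult_of X \<equiv> fst (snd X)"

abbreviation counit_of :: "('o, 'm) cof_ob \<Rightarrow> 'm" where
  "counit_of X \<equiv> snd (snd X)"

context
  fixes C :: "('o, 'm, 'x) smc_scheme" (structure) and bar :: "'m \<Rightarrow> 'm"
begin

definition cof_obs :: "('o, 'm) cof_ob set" where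
  "cof_obs = {(A, \<mu>, \<epsilon>). involutive_comonoid C bar A \<mu> \<epsilon>}"

definition cof_tensor :: "('o, 'm) cof_ob \<Rightarrow> ('o, 'm) cof_ob \<Rightarrow> ('o, 'm) cof_ob" where
  "cof_tensor X Y =
    (carrier_of X \<odot> carrier_of Y,
     tensor_copy C (carrier_of X) (comult_of X) (carrier_of Y) (comult_of Y),
     tensor_del C (counit_of X) (counit_of Y))"

definition cof_unit :: "('o, 'm) cof_ob" where
  "cof_unit = (\<I>, unit_copy C, \<one> \<I>)"

definition Cof :: "(('o, 'm) cof_ob, ('o, 'm) cof_hom) smc" where
  "Cof = \<lparr>
    Objects = cof_obs,
    Homset = (\<lambda>X Y. {(X, f, Y) | f. X \<in> cof_obs \<and> Y \<in> cof_obs \<and> f \<in> Hom (carrier_of X) (carrier_of Y)}),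
    Id = (\<lambda>X. (X, \<one> (carrier_of X), X)),
    Comp = (\<lambda>(_, g, Z) (X, f, _). (X, g \<cdot> f, Z)),
    Unit = cof_unit,
    TensorOb = cof_tensor,
    TensorHom = (\<lambda>(X, f, Y) (X', g, Y'). (cof_tensor X X', f \<otimes> g, cof_tensor Y Y')),
    Assoc = (\<lambda>X Y Z. (cof_tensor (cof_tensor X Y) Z,
                      \<alpha> (carrier_of X) (carrier_of Y) (carrier_of Z),
                      cof_tensor X (cof_tensor Y Z))),
    LUnit = (\<lambda>X. (cof_tensor cof_unit X, \<l> (carrier_of X), X)),
    RUnit = (\<lambda>X. (cof_tensor X cof_unit, \<r> (carrier_of X), X)),
    Swap = (\<lambda>X Y. (cof_tensor X Y, \<sigma> (carrier_of X) (carrier_of Y), cof_tensor Y X)) \<rparr>"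

end

end

theory Submission
  imports Defs
begin

text \<open>
  The laws of an ICD-category that concern a single object of \<open>Cof(C)\<close>, namely coassociativity,
  counitality and compatibility with the involution, are exactly what it means for that object to be
  an involutive comonoid, and the laws about \<open>copy\<close> and \<open>del\<close> on tensor products and on the unit
  are the definitions of the tensor product and the unit of \<open>Cof(C)\<close>. Every equation between
  parallel morphisms of \<open>Cof(C)\<close> is an equation between the underlying morphisms of \<open>C\<close>. What remains to be
  shown is that \<open>Cof(C)\<close> has a tensor product and a unit at all: that the product of two involutive
  comonoids is an involutive comonoid, and that the unit object is one.

  For the product, naturality pulls the middle-four interchange \<open>m\<close> out of each law, whereupon the
  laws of the factors apply; the remaining equations relate \<open>m\<close> to the structure isomorphisms.
  They say that \<open>\<odot>\<close>, with \<open>m\<close> as its monoidal structure, is a symmetric monoidal functor in two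
  variables: \<open>m\<close> is compatible with associativity (\<open>interchange_assoc\<close>), with the units
  (\<open>interchange_lunit\<close>, \<open>interchange_runit\<close>) and with the symmetry (\<open>interchange_swap\<close>). The
  last of these gives the law for the involution, because the involution fixes \<open>m\<close> and turns
  \<open>\<mu> \<otimes> \<nu>\<close> into \<open>(\<sigma> \<otimes> \<sigma>) \<cdot> (\<mu> \<otimes> \<nu>)\<close>.

  Instead of appealing to a coherence theorem, the proofs of these four equations move all
  brackets to the right. There \<open>m\<close> becomes \<open>\<one> \<otimes> s\<close>, where
  \<open>s : A \<odot> (B \<odot> X) \<rightarrow> B \<odot> (A \<odot> X)\<close> (\<open>swap_at\<close>) exchanges the first two factors of a nested
  product. Both hexagons hold for \<open>s\<close> (\<open>swap_at_tensor_right\<close>, \<open>swap_at_tensor_left\<close>), and \<open>s\<close> is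
  natural and compatible with enlarging \<open>X\<close> (\<open>swap_at_tensor\<close>), so that the four equations reduce
  to short calculations with adjacent transpositions, as in the strict case. The unit laws also
  require Kelly's consequences of the axioms, such as \<open>\<l> \<I> = \<r> \<I>\<close>.
\<close>

section \<open>Sources and targets\<close>

text \<open>
  Since hom-sets are disjoint, a morphism determines its source and target. With \<open>src\<close> and \<open>tgt\<close>
  as functions, composability becomes a set of equations that rewriting decides, whereas the
  intermediate object in \<open>f \<in> Hom A B \<Longrightarrow> g \<in> Hom B D \<Longrightarrow> g \<cdot> f \<in> Hom A D\<close> would have to be guessed.
\<close>

context category
begin

definition arr :: "'m \<Rightarrow> bool" where
  "arr f \<longleftrightarrow> (\<exists>A B. f \<in> Hom A B)"

definition src :: "'m \<Rightarrow> 'o" where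
  "src f = (THE A. \<exists>B. f \<in> Hom A B)"

definition tgt :: "'m \<Rightarrow> 'o" where
  "tgt f = (THE B. \<exists>A. f \<in> Hom A B)"

lemma in_homD:
  assumes "f \<in> Hom A B"
  shows "arr f" "src f = A" "tgt f = B"
  unfolding arr_def src_def tgt_def using assms hom_disjoint by blast+

lemma in_hom_iff: "f \<in> Hom A B \<longleftrightarrow> arr f \<and> src f = A \<and> tgt f = B"
  using in_homD arr_def by metis

lemma src_ob [simp]: "arr f \<Longrightarrow> src f \<in> Ob"
  and tgt_ob [simp]: "arr f \<Longrightarrow> tgt f \<in> Ob"
  using hom_ob in_hom_iff by blast+

lemma id_typing [simp]:
  assumes "A \<in> Ob"
  shows "arr (\<one> A)" "src (\<one> A) = A" "tgt (\<one> A) = A"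
  using in_homD[OF id_hom[OF assms]] .

lemma comp_typing [simp]:
  assumes "arr f" "arr g" "tgt f = src g"
  shows "arr (g \<cdot> f)" "src (g \<cdot> f) = src f" "tgt (g \<cdot> f) = tgt g"
  using in_homD[OF comp_hom[of f "src f" "src g" g "tgt g"]] assms by (auto simp: in_hom_iff)

lemma comp_id_left [simp]: "arr f \<Longrightarrow> tgt f = B \<Longrightarrow> \<one> B \<cdot> f = f"
  and comp_id_right [simp]: "arr f \<Longrightarrow> src f = A \<Longrightarrow> f \<cdot> \<one> A = f"
  using id_left id_right in_hom_iff by blast+

lemma comp_assoc_arr:
  "arr f \<Longrightarrow> arr g \<Longrightarrow> arr h \<Longrightarrow> tgt f = src g \<Longrightarrow> tgt g = src h \<Longrightarrow>
    (h \<cdot> g) \<cdot> f = h \<cdot> (g \<cdot> f)"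
  using comp_assoc in_hom_iff by blast

text \<open>
  Composites are kept bracketed to the right; this turns an equation for a composite of two
  morphisms into a rewrite rule that applies in the middle of a longer chain.
\<close>
lemma comp_extend:
  assumes "h \<cdot> g = k" "arr f" "arr g" "arr h" "tgt f = src g" "tgt g = src h"
  shows "h \<cdot> (g \<cdot> f) = k \<cdot> f"
  using assms comp_assoc_arr by metis

lemma inverse_morphisms_unique:
  assumes "inverse_morphisms C f g" "inverse_morphisms C f h"
  shows "g = h"
proof -
  from assms have "g \<cdot> (f \<cdot> h) = g" "(g \<cdot> f) \<cdot> h = h"
    "arr f" "arr g" "arr h" "tgt h = src f" "tgt f = src g"
    by (auto simp: inverse_morphisms_def in_hom_iff)
  then show ?thesis
    using comp_assoc_arr by metis
qed

lemma inverse_of_eq: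
  assumes "inverse_morphisms C f g"
  shows "inverse_of C f = g"
  unfolding inverse_of_def using assms inverse_morphisms_unique by blast

lemma inverse_morphisms_inverse_of: "is_iso C f \<Longrightarrow> inverse_morphisms C f (inverse_of C f)"
  using inverse_of_eq is_iso_def by metis

lemma iso_inverse:
  assumes "is_iso C f"
  shows "arr f" "arr (inverse_of C f)" "src (inverse_of C f) = tgt f" "tgt (inverse_of C f) = src f"
    "inverse_of C f \<cdot> f = \<one> (src f)" "f \<cdot> inverse_of C f = \<one> (tgt f)"
  using inverse_morphisms_inverse_of[OF assms]
  by (auto simp: inverse_morphisms_def in_hom_iff)

lemma inverse_morphismsI:
  assumes "arr f" "arr g" "tgt f = src g" "tgt g = src f" "g \<cdot> f = \<one> (src f)" "f \<cdot> g = \<one> (tgt f)"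
  shows "inverse_morphisms C f g"
  using assms by (auto simp: inverse_morphisms_def in_hom_iff)

lemma iso_cancel_left:
  assumes "is_iso C h" "h \<cdot> f = h \<cdot> g" "arr f" "arr g" "tgt f = src h" "tgt g = src h"
  shows "f = g"
proof -
  have "inverse_of C h \<cdot> (h \<cdot> k) = k" if "arr k" "tgt k = src h" for k
    using that assms(1) by (simp add: iso_inverse comp_extend[OF iso_inverse(5)])
  then show ?thesis
    using assms by metis
qed

lemma iso_cancel_right:
  assumes "is_iso C h" "f \<cdot> h = g \<cdot> h" "arr f" "arr g" "src f = tgt h" "src g = tgt h"
  shows "f = g"
proof -
  have "(k \<cdot> h) \<cdot> inverse_of C h = k" if "arr k" "src k = tgt h" for k
    using that assms(1) by (simp add: iso_inverse comp_assoc_arr)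
  then show ?thesis
    using assms by metis
qed

end


section \<open>Calculating in a symmetric monoidal category\<close>

context symmetric_monoidal_category
begin

abbreviation assoc_inv :: "'o \<Rightarrow> 'o \<Rightarrow> 'o \<Rightarrow> 'm"  (\<open>\<alpha>\<^sup>-\<close>) where
  "\<alpha>\<^sup>- A B D \<equiv> inverse_of C (\<alpha> A B D)"

declare unit_ob [simp] tensor_ob [simp] tensor_id [simp] assoc_iso [simp] lunit_iso [simp] runit_iso [simp]

lemma tensor_typing [simp]:
  assumes "arr f" "arr g"
  shows "arr (f \<otimes> g)" "src (f \<otimes> g) = src f \<odot> src g" "tgt (f \<otimes> g) = tgt f \<odot> tgt g"
  using in_homD[OF tensor_hom[of f "src f" "tgt f" g "src g" "tgt g"]] assms
  by (auto simp: in_hom_iff)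

lemma assoc_typing [simp]:
  assumes "A \<in> Ob" "B \<in> Ob" "D \<in> Ob"
  shows "arr (\<alpha> A B D)" "src (\<alpha> A B D) = (A \<odot> B) \<odot> D" "tgt (\<alpha> A B D) = A \<odot> (B \<odot> D)"
    "arr (\<alpha>\<^sup>- A B D)" "src (\<alpha>\<^sup>- A B D) = A \<odot> (B \<odot> D)" "tgt (\<alpha>\<^sup>- A B D) = (A \<odot> B) \<odot> D"
  using in_homD[OF assoc_hom[OF assms]] iso_inverse[OF assoc_iso[OF assms]] by simp_all

lemma unit_typing [simp]:
  assumes "A \<in> Ob"
  shows "arr (\<l> A)" "src (\<l> A) = \<I> \<odot> A" "tgt (\<l> A) = A"
    "arr (\<r> A)" "src (\<r> A) = A \<odot> \<I>" "tgt (\<r> A) = A"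
  using in_homD[OF lunit_hom[OF assms]] in_homD[OF runit_hom[OF assms]] by simp_all

lemma swap_typing [simp]:
  assumes "A \<in> Ob" "B \<in> Ob"
  shows "arr (\<sigma> A B)" "src (\<sigma> A B) = A \<odot> B" "tgt (\<sigma> A B) = B \<odot> A"
  using in_homD[OF swap_hom[OF assms]] by simp_all

lemma swap_iso [simp]: "A \<in> Ob \<Longrightarrow> B \<in> Ob \<Longrightarrow> is_iso C (\<sigma> A B)"
  unfolding is_iso_def
  by (intro exI[of _ "\<sigma> B A"] inverse_morphismsI) (simp_all add: swap_swap)

lemma tensor_comp_arr:
  "arr f \<Longrightarrow> arr f' \<Longrightarrow> arr g \<Longrightarrow> arr g' \<Longrightarrow> tgt f = src f' \<Longrightarrow> tgt g = src g' \<Longrightarrow>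
    (f' \<otimes> g') \<cdot> (f \<otimes> g) = (f' \<cdot> f) \<otimes> (g' \<cdot> g)"
  using tensor_comp in_hom_iff by metis

lemma tensor_comp_extend:
  assumes "arr f" "arr f'" "arr g" "arr g'" "tgt f = src f'" "tgt g = src g'"
    "arr h" "tgt h = src f \<odot> src g"
  shows "(f' \<otimes> g') \<cdot> ((f \<otimes> g) \<cdot> h) = ((f' \<cdot> f) \<otimes> (g' \<cdot> g)) \<cdot> h"
  using assms comp_extend[OF tensor_comp_arr] by simp

lemmas tensor_merge = tensor_comp_arr tensor_comp_extend

lemma tensor_iso [simp]:
  assumes "is_iso C f" "is_iso C g"
  shows "is_iso C (f \<otimes> g)"
  unfolding is_iso_def using assms
  by (intro exI[of _ "inverse_of C f \<otimes> inverse_of C g"] inverse_morphismsI)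
    (simp_all add: iso_inverse tensor_merge)

lemma id_iso [simp]: "A \<in> Ob \<Longrightarrow> is_iso C (\<one> A)"
  unfolding is_iso_def by (intro exI[of _ "\<one> A"] inverse_morphismsI) simp_all

lemma assoc_cancel [simp]:
  assumes "A \<in> Ob" "B \<in> Ob" "D \<in> Ob"
  shows "\<alpha>\<^sup>- A B D \<cdot> \<alpha> A B D = \<one> ((A \<odot> B) \<odot> D)" "\<alpha> A B D \<cdot> \<alpha>\<^sup>- A B D = \<one> (A \<odot> (B \<odot> D))"
    and "arr f \<Longrightarrow> tgt f = (A \<odot> B) \<odot> D \<Longrightarrow> \<alpha>\<^sup>- A B D \<cdot> (\<alpha> A B D \<cdot> f) = f"
    and "arr f \<Longrightarrow> tgt f = A \<odot> (B \<odot> D) \<Longrightarrow> \<alpha> A B D \<cdot> (\<alpha>\<^sup>- A B D \<cdot> f) = f"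
proof -
  show *: "\<alpha>\<^sup>- A B D \<cdot> \<alpha> A B D = \<one> ((A \<odot> B) \<odot> D)" "\<alpha> A B D \<cdot> \<alpha>\<^sup>- A B D = \<one> (A \<odot> (B \<odot> D))"
    using iso_inverse[OF assoc_iso[OF assms]] assms by simp_all
  show "arr f \<Longrightarrow> tgt f = (A \<odot> B) \<odot> D \<Longrightarrow> \<alpha>\<^sup>- A B D \<cdot> (\<alpha> A B D \<cdot> f) = f"
    "arr f \<Longrightarrow> tgt f = A \<odot> (B \<odot> D) \<Longrightarrow> \<alpha> A B D \<cdot> (\<alpha>\<^sup>- A B D \<cdot> f) = f"
    using assms by (simp_all add: comp_extend[OF *(1)] comp_extend[OF *(2)])
qed

lemma swap_cancel [simp]:
  assumes "A \<in> Ob" "B \<in> Ob"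
  shows "\<sigma> B A \<cdot> \<sigma> A B = \<one> (A \<odot> B)"
    and "arr f \<Longrightarrow> tgt f = A \<odot> B \<Longrightarrow> \<sigma> B A \<cdot> (\<sigma> A B \<cdot> f) = f"
  using assms by (simp_all add: swap_swap comp_extend[OF swap_swap])

lemma assoc_natural_arr:
  assumes "arr f" "arr g" "arr h" "A = tgt f" "B = tgt g" "D = tgt h"
  shows "\<alpha> A B D \<cdot> ((f \<otimes> g) \<otimes> h) = (f \<otimes> (g \<otimes> h)) \<cdot> \<alpha> (src f) (src g) (src h)"
  using assms assoc_natural in_hom_iff by metis

lemma lunit_natural_arr: "arr f \<Longrightarrow> A = tgt f \<Longrightarrow> \<l> A \<cdot> (\<one> \<I> \<otimes> f) = f \<cdot> \<l> (src f)"
  and runit_natural_arr: "arr f \<Longrightarrow> A = tgt f \<Longrightarrow> \<r> A \<cdot> (f \<otimes> \<one> \<I>) = f \<cdot> \<r> (src f)"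
  using lunit_natural runit_natural in_hom_iff by blast+

lemma swap_natural_arr:
  "arr f \<Longrightarrow> arr g \<Longrightarrow> A = tgt f \<Longrightarrow> B = tgt g \<Longrightarrow>
    \<sigma> A B \<cdot> (f \<otimes> g) = (g \<otimes> f) \<cdot> \<sigma> (src f) (src g)"
  using swap_natural in_hom_iff by blast

section \<open>Kelly's coherence laws for the unit\<close>

text \<open>Naturality of \<open>\<l>\<close> expresses \<open>f\<close> through \<open>\<one> \<I> \<otimes> f\<close> and isomorphisms.\<close>
lemma tensor_unit_left_faithful:
  assumes "\<one> \<I> \<otimes> f = \<one> \<I> \<otimes> g" "arr f" "arr g" "src f = src g" "tgt f = tgt g"
  shows "f = g"
proof (rule iso_cancel_right)
  show "f \<cdot> \<l> (src f) = g \<cdot> \<l> (src f)"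
    using assms lunit_natural_arr by metis
qed (use assms in simp_all)

lemma tensor_unit_right_faithful:
  assumes "f \<otimes> \<one> \<I> = g \<otimes> \<one> \<I>" "arr f" "arr g" "src f = src g" "tgt f = tgt g"
  shows "f = g"
proof (rule iso_cancel_right)
  show "f \<cdot> \<r> (src f) = g \<cdot> \<r> (src f)"
    using assms runit_natural_arr by metis
qed (use assms in simp_all)

text \<open>
  By faithfulness of \<open>\<one> \<I> \<otimes> _\<close> and invertibility of \<open>\<alpha>\<close>, it suffices to compare after tensoring
  with \<open>\<I>\<close> on the left and composing with two sides of the pentagon for \<open>\<I>, \<I>, A, B\<close>; there the
  triangle turns both sides into composites with \<open>\<r> \<I>\<close>.
\<close>
lemma lunit_tensor:
  assumes [simp]: "A \<in> Ob" "B \<in> Ob"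
  shows "\<l> (A \<odot> B) \<cdot> \<alpha> \<I> A B = \<l> A \<otimes> \<one> B"
proof (rule tensor_unit_left_faithful)
  let ?k = "\<alpha> \<I> (\<I> \<odot> A) B \<cdot> (\<alpha> \<I> \<I> A \<otimes> \<one> B)"
  have "(\<one> \<I> \<otimes> (\<l> (A \<odot> B) \<cdot> \<alpha> \<I> A B)) \<cdot> ?k
      = (\<one> \<I> \<otimes> \<l> (A \<odot> B)) \<cdot> (\<one> \<I> \<otimes> \<alpha> \<I> A B) \<cdot> ?k"
    by (simp add: tensor_merge)
  also have "\<dots> = (\<one> \<I> \<otimes> \<l> (A \<odot> B)) \<cdot> \<alpha> \<I> \<I> (A \<odot> B) \<cdot> \<alpha> (\<I> \<odot> \<I>) A B"
    by (simp add: pentagon)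
  also have "\<dots> = (\<r> \<I> \<otimes> (\<one> A \<otimes> \<one> B)) \<cdot> \<alpha> (\<I> \<odot> \<I>) A B"
    by (simp add: comp_extend[OF triangle])
  also have "\<dots> = \<alpha> \<I> A B \<cdot> (((\<one> \<I> \<otimes> \<l> A) \<cdot> \<alpha> \<I> \<I> A) \<otimes> \<one> B)"
    by (simp add: assoc_natural_arr triangle del: tensor_id)
  also have "\<dots> = \<alpha> \<I> A B \<cdot> ((\<one> \<I> \<otimes> \<l> A) \<otimes> \<one> B) \<cdot> (\<alpha> \<I> \<I> A \<otimes> \<one> B)"
    by (simp add: tensor_merge)
  also have "\<dots> = (\<one> \<I> \<otimes> (\<l> A \<otimes> \<one> B)) \<cdot> ?k"
    by (simp add: comp_extend[OF assoc_natural_arr] comp_assoc_arr)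
  finally have "((\<one> \<I> \<otimes> (\<l> (A \<odot> B) \<cdot> \<alpha> \<I> A B)) \<cdot> \<alpha> \<I> (\<I> \<odot> A) B) \<cdot> (\<alpha> \<I> \<I> A \<otimes> \<one> B)
      = ((\<one> \<I> \<otimes> (\<l> A \<otimes> \<one> B)) \<cdot> \<alpha> \<I> (\<I> \<odot> A) B) \<cdot> (\<alpha> \<I> \<I> A \<otimes> \<one> B)"
    by (simp add: comp_assoc_arr)
  then have "(\<one> \<I> \<otimes> (\<l> (A \<odot> B) \<cdot> \<alpha> \<I> A B)) \<cdot> \<alpha> \<I> (\<I> \<odot> A) B
      = (\<one> \<I> \<otimes> (\<l> A \<otimes> \<one> B)) \<cdot> \<alpha> \<I> (\<I> \<odot> A) B"
    by (rule iso_cancel_right[rotated]) simp_all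
  then show "\<one> \<I> \<otimes> (\<l> (A \<odot> B) \<cdot> \<alpha> \<I> A B) = \<one> \<I> \<otimes> (\<l> A \<otimes> \<one> B)"
    by (rule iso_cancel_right[rotated]) simp_all
qed simp_all

text \<open>The mirror image, from the pentagon for \<open>A, B, \<I>, \<I>\<close>.\<close>
lemma runit_tensor:
  assumes [simp]: "A \<in> Ob" "B \<in> Ob"
  shows "(\<one> A \<otimes> \<r> B) \<cdot> \<alpha> A B \<I> = \<r> (A \<odot> B)"
proof (rule tensor_unit_right_faithful)
  have "\<alpha> A B \<I> \<cdot> (((\<one> A \<otimes> \<r> B) \<cdot> \<alpha> A B \<I>) \<otimes> \<one> \<I>)
      = \<alpha> A B \<I> \<cdot> ((\<one> A \<otimes> \<r> B) \<otimes> \<one> \<I>) \<cdot> (\<alpha> A B \<I> \<otimes> \<one> \<I>)"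
    by (simp add: tensor_merge)
  also have "\<dots> = (\<one> A \<otimes> (\<r> B \<otimes> \<one> \<I>)) \<cdot> \<alpha> A (B \<odot> \<I>) \<I> \<cdot> (\<alpha> A B \<I> \<otimes> \<one> \<I>)"
    by (simp add: comp_extend[OF assoc_natural_arr] comp_assoc_arr)
  also have "\<dots> = (\<one> A \<otimes> (\<one> B \<otimes> \<l> \<I>)) \<cdot> (\<one> A \<otimes> \<alpha> B \<I> \<I>) \<cdot> \<alpha> A (B \<odot> \<I>) \<I> \<cdot> (\<alpha> A B \<I> \<otimes> \<one> \<I>)"
    by (simp add: tensor_merge triangle)
  also have "\<dots> = (\<one> A \<otimes> (\<one> B \<otimes> \<l> \<I>)) \<cdot> \<alpha> A B (\<I> \<odot> \<I>) \<cdot> \<alpha> (A \<odot> B) \<I> \<I>"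
    by (simp add: pentagon)
  also have "\<dots> = \<alpha> A B \<I> \<cdot> ((\<one> A \<otimes> \<one> B) \<otimes> \<l> \<I>) \<cdot> \<alpha> (A \<odot> B) \<I> \<I>"
    by (simp add: comp_extend[OF assoc_natural_arr] comp_assoc_arr del: tensor_id)
  also have "\<dots> = \<alpha> A B \<I> \<cdot> (\<r> (A \<odot> B) \<otimes> \<one> \<I>)"
    by (simp add: triangle)
  finally show "((\<one> A \<otimes> \<r> B) \<cdot> \<alpha> A B \<I>) \<otimes> \<one> \<I> = \<r> (A \<odot> B) \<otimes> \<one> \<I>"
    by (rule iso_cancel_left[rotated]) simp_all
qed simp_all

text \<open>
  Naturality of \<open>\<l>\<close> at the morphism \<open>\<l> \<I>\<close> gives \<open>\<l> (\<I> \<odot> \<I>) = \<one> \<I> \<otimes> \<l> \<I>\<close>. Hence \<open>lunit_tensor\<close> and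
  the triangle identify \<open>\<l> \<I> \<otimes> \<one> \<I>\<close> and \<open>\<r> \<I> \<otimes> \<one> \<I>\<close> with the same morphism.
\<close>
lemma lunit_unit: "\<l> \<I> = \<r> \<I>"
proof (rule tensor_unit_right_faithful)
  have "\<l> \<I> \<cdot> (\<one> \<I> \<otimes> \<l> \<I>) = \<l> \<I> \<cdot> \<l> (\<I> \<odot> \<I>)"
    by (simp add: lunit_natural_arr)
  then have "\<one> \<I> \<otimes> \<l> \<I> = \<l> (\<I> \<odot> \<I>)"
    by (rule iso_cancel_left[rotated]) simp_all
  then show "\<l> \<I> \<otimes> \<one> \<I> = \<r> \<I> \<otimes> \<one> \<I>"
    using lunit_tensor[of \<I> \<I>] triangle[of \<I> \<I>] by simp
qed simp_all


section \<open>Exchanging the first two factors of a nested product\<close>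

text \<open>
  In a strict category this is \<open>\<sigma> A B \<otimes> \<one> X\<close>. Keeping the passive factor \<open>X\<close> as a parameter makes
  the transposition an operation on products bracketed to the right.
\<close>
definition swap_at :: "'o \<Rightarrow> 'o \<Rightarrow> 'o \<Rightarrow> 'm" where
  "swap_at A B X = \<alpha> B A X \<cdot> (\<sigma> A B \<otimes> \<one> X) \<cdot> \<alpha>\<^sup>- A B X"

lemma swap_at_typing [simp]:
  assumes "A \<in> Ob" "B \<in> Ob" "X \<in> Ob"
  shows "arr (swap_at A B X)" "src (swap_at A B X) = A \<odot> (B \<odot> X)"
    "tgt (swap_at A B X) = B \<odot> (A \<odot> X)"
  using assms by (simp_all add: swap_at_def)

lemma swap_at_assoc:
  assumes "A \<in> Ob" "B \<in> Ob" "X \<in> Ob"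
  shows "swap_at A B X \<cdot> \<alpha> A B X = \<alpha> B A X \<cdot> (\<sigma> A B \<otimes> \<one> X)"
  using assms by (simp add: swap_at_def comp_assoc_arr)

lemma swap_at_swap_at [simp]:
  assumes [simp]: "A \<in> Ob" "B \<in> Ob" "X \<in> Ob"
  shows "swap_at B A X \<cdot> swap_at A B X = \<one> (A \<odot> (B \<odot> X))"
  by (simp add: swap_at_def comp_assoc_arr tensor_merge)

lemma swap_at_natural:
  assumes [simp]: "arr f" "arr g" "arr h" and "A = tgt f" "B = tgt g" "X = tgt h"
  shows "swap_at A B X \<cdot> (f \<otimes> (g \<otimes> h)) = (g \<otimes> (f \<otimes> h)) \<cdot> swap_at (src f) (src g) (src h)"
proof -
  have [simp]: "A = tgt f" "B = tgt g" "X = tgt h" by fact+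
  have "(swap_at A B X \<cdot> (f \<otimes> (g \<otimes> h))) \<cdot> \<alpha> (src f) (src g) (src h)
      = swap_at A B X \<cdot> \<alpha> A B X \<cdot> ((f \<otimes> g) \<otimes> h)"
    by (simp add: assoc_natural_arr comp_assoc_arr)
  also have "\<dots> = \<alpha> B A X \<cdot> (\<sigma> A B \<otimes> \<one> X) \<cdot> ((f \<otimes> g) \<otimes> h)"
    by (simp add: comp_extend[OF swap_at_assoc] comp_assoc_arr)
  also have "\<dots> = \<alpha> B A X \<cdot> ((g \<otimes> f) \<otimes> h) \<cdot> (\<sigma> (src f) (src g) \<otimes> \<one> (src h))"
    by (simp add: tensor_merge swap_natural_arr)
  also have "\<dots> = (g \<otimes> (f \<otimes> h)) \<cdot> \<alpha> (src g) (src f) (src h) \<cdot> (\<sigma> (src f) (src g) \<otimes> \<one> (src h))"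
    by (simp add: comp_extend[OF assoc_natural_arr] comp_assoc_arr)
  also have "\<dots> = ((g \<otimes> (f \<otimes> h)) \<cdot> swap_at (src f) (src g) (src h)) \<cdot> \<alpha> (src f) (src g) (src h)"
    by (simp add: swap_at_assoc comp_assoc_arr)
  finally show ?thesis
    by (rule iso_cancel_right[rotated]) simp_all
qed

text \<open>
  Tensoring with \<open>Y\<close> on the right only enlarges the passive factor. This is what allows one
  interchange to be calculated inside a larger product; it combines the pentagons for
  \<open>B, A, X, Y\<close> and \<open>A, B, X, Y\<close> with naturality of \<open>\<alpha>\<close> in its first argument.
\<close>
lemma swap_at_tensor:
  assumes [simp]: "A \<in> Ob" "B \<in> Ob" "X \<in> Ob" "Y \<in> Ob"
  shows "(\<one> B \<otimes> \<alpha> A X Y) \<cdot> \<alpha> B (A \<odot> X) Y \<cdot> (swap_at A B X \<otimes> \<one> Y)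
    = swap_at A B (X \<odot> Y) \<cdot> (\<one> A \<otimes> \<alpha> B X Y) \<cdot> \<alpha> A (B \<odot> X) Y"
    (is "?l = ?r")
proof -
  have "?l \<cdot> (\<alpha> A B X \<otimes> \<one> Y)
      = (\<one> B \<otimes> \<alpha> A X Y) \<cdot> \<alpha> B (A \<odot> X) Y \<cdot> (\<alpha> B A X \<otimes> \<one> Y) \<cdot> ((\<sigma> A B \<otimes> \<one> X) \<otimes> \<one> Y)"
    by (simp add: comp_assoc_arr tensor_merge swap_at_assoc)
  also have "\<dots> = ((\<one> B \<otimes> \<alpha> A X Y) \<cdot> \<alpha> B (A \<odot> X) Y \<cdot> (\<alpha> B A X \<otimes> \<one> Y)) \<cdot> ((\<sigma> A B \<otimes> \<one> X) \<otimes> \<one> Y)"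
    by (simp add: comp_assoc_arr)
  also have "\<dots> = \<alpha> B A (X \<odot> Y) \<cdot> \<alpha> (B \<odot> A) X Y \<cdot> ((\<sigma> A B \<otimes> \<one> X) \<otimes> \<one> Y)"
    by (simp add: pentagon[symmetric] comp_assoc_arr)
  also have "\<dots> = \<alpha> B A (X \<odot> Y) \<cdot> (\<sigma> A B \<otimes> \<one> (X \<odot> Y)) \<cdot> \<alpha> (A \<odot> B) X Y"
    by (simp add: assoc_natural_arr)
  also have "\<dots> = swap_at A B (X \<odot> Y) \<cdot> \<alpha> A B (X \<odot> Y) \<cdot> \<alpha> (A \<odot> B) X Y"
    by (simp add: comp_extend[OF swap_at_assoc] comp_assoc_arr)
  also have "\<dots> = ?r \<cdot> (\<alpha> A B X \<otimes> \<one> Y)"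
    by (simp add: pentagon comp_assoc_arr)
  finally show ?thesis
    by (rule iso_cancel_right[rotated]) simp_all
qed

text \<open>The hexagon with one associator cancelled: moving past a product is done in two steps.\<close>
lemma swap_tensor_right:
  assumes [simp]: "A \<in> Ob" "B \<in> Ob" "D \<in> Ob"
  shows "\<alpha> B D A \<cdot> \<sigma> A (B \<odot> D) = (\<one> B \<otimes> \<sigma> A D) \<cdot> swap_at A B D"
proof -
  have "(\<alpha> B D A \<cdot> \<sigma> A (B \<odot> D)) \<cdot> \<alpha> A B D = ((\<one> B \<otimes> \<sigma> A D) \<cdot> swap_at A B D) \<cdot> \<alpha> A B D"
    by (simp add: hexagon comp_assoc_arr swap_at_assoc)
  then show ?thesis
    by (rule iso_cancel_right[rotated]) simp_all
qed

text \<open>The inverse of the preceding equation, with the names of the factors permuted.\<close>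
lemma swap_tensor_left:
  assumes [simp]: "A \<in> Ob" "B \<in> Ob" "D \<in> Ob"
  shows "\<sigma> (A \<odot> B) D = swap_at A D B \<cdot> (\<one> A \<otimes> \<sigma> B D) \<cdot> \<alpha> A B D"
proof -
  have "\<sigma> (A \<odot> B) D = swap_at A D B \<cdot> (\<one> A \<otimes> \<sigma> B D) \<cdot> ((\<one> A \<otimes> \<sigma> D B) \<cdot> swap_at D A B) \<cdot> \<sigma> (A \<odot> B) D"
    by (simp add: comp_extend[OF swap_at_swap_at] comp_assoc_arr tensor_merge)
  also have "\<dots> = swap_at A D B \<cdot> (\<one> A \<otimes> \<sigma> B D) \<cdot> \<alpha> A B D"
    by (simp add: swap_tensor_right[symmetric] comp_assoc_arr)
  finally show ?thesis .
qed

text \<open>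
  The hexagon in the presence of a passive factor: \<open>A\<close> passes \<open>B \<odot> D\<close> by first passing \<open>B\<close> and then
  \<open>D\<close>.
\<close>
lemma swap_at_tensor_right:
  assumes [simp]: "A \<in> Ob" "B \<in> Ob" "D \<in> Ob" "X \<in> Ob"
  shows "\<alpha> B D (A \<odot> X) \<cdot> swap_at A (B \<odot> D) X
    = (\<one> B \<otimes> swap_at A D X) \<cdot> swap_at A B (D \<odot> X) \<cdot> (\<one> A \<otimes> \<alpha> B D X)"
    (is "?l = ?r")
proof -
  have "?l \<cdot> \<alpha> A (B \<odot> D) X = \<alpha> B D (A \<odot> X) \<cdot> \<alpha> (B \<odot> D) A X \<cdot> (\<sigma> A (B \<odot> D) \<otimes> \<one> X)"
    by (simp add: swap_at_assoc comp_assoc_arr)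
  also have "\<dots> = (\<one> B \<otimes> \<alpha> D A X) \<cdot> \<alpha> B (D \<odot> A) X \<cdot> (\<alpha> B D A \<otimes> \<one> X) \<cdot> (\<sigma> A (B \<odot> D) \<otimes> \<one> X)"
    by (simp add: comp_extend[OF pentagon] comp_assoc_arr)
  also have "\<dots> = (\<one> B \<otimes> \<alpha> D A X) \<cdot> \<alpha> B (D \<odot> A) X \<cdot> ((\<one> B \<otimes> \<sigma> A D) \<otimes> \<one> X) \<cdot> (swap_at A B D \<otimes> \<one> X)"
    by (simp add: tensor_merge swap_tensor_right)
  also have "\<dots> = (\<one> B \<otimes> \<alpha> D A X) \<cdot> (\<one> B \<otimes> (\<sigma> A D \<otimes> \<one> X)) \<cdot> \<alpha> B (A \<odot> D) X \<cdot> (swap_at A B D \<otimes> \<one> X)"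
    by (simp add: comp_extend[OF assoc_natural_arr] comp_assoc_arr)
  also have "\<dots> = (\<one> B \<otimes> swap_at A D X) \<cdot> (\<one> B \<otimes> \<alpha> A D X) \<cdot> \<alpha> B (A \<odot> D) X \<cdot> (swap_at A B D \<otimes> \<one> X)"
    by (simp add: tensor_merge swap_at_assoc)
  also have "\<dots> = ?r \<cdot> \<alpha> A (B \<odot> D) X"
    by (simp add: swap_at_tensor comp_assoc_arr)
  finally show ?thesis
    by (rule iso_cancel_right[rotated]) simp_all
qed

text \<open>The other hexagon is the inverse of the first, because transpositions are involutive.\<close>
lemma swap_at_tensor_left:
  assumes [simp]: "A \<in> Ob" "B \<in> Ob" "D \<in> Ob" "X \<in> Ob"
  shows "(\<one> D \<otimes> \<alpha> A B X) \<cdot> swap_at (A \<odot> B) D X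
    = swap_at A D (B \<odot> X) \<cdot> (\<one> A \<otimes> swap_at B D X) \<cdot> \<alpha> A B (D \<odot> X)"
    (is "?l = ?r")
proof -
  have "?l = swap_at A D (B \<odot> X) \<cdot> (\<one> A \<otimes> swap_at B D X) \<cdot>
      ((\<one> A \<otimes> swap_at D B X) \<cdot> swap_at D A (B \<odot> X) \<cdot> (\<one> D \<otimes> \<alpha> A B X)) \<cdot> swap_at (A \<odot> B) D X"
    by (simp add: comp_extend[OF swap_at_swap_at] comp_assoc_arr tensor_merge)
  also have "\<dots> = ?r"
    by (simp add: swap_at_tensor_right[symmetric] comp_assoc_arr)
  finally show ?thesis .
qed

section \<open>The symmetry and the unit\<close>

text \<open>
  After tensoring with \<open>\<I>\<close>, the left unit isomorphism of \<open>A\<close> becomes that of \<open>A \<odot> \<I>\<close>, and naturality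
  brings the composite into the form of a hexagon for \<open>A, \<I>, \<I>\<close>. The additional factor \<open>\<sigma> A \<I>\<close> on
  the left, which is cancelled at the end, supplies the missing side of that hexagon.
\<close>
lemma lunit_swap:
  assumes [simp]: "A \<in> Ob"
  shows "\<l> A \<cdot> \<sigma> A \<I> = \<r> A"
proof (rule tensor_unit_right_faithful)
  have "\<sigma> A \<I> \<cdot> ((\<l> A \<cdot> \<sigma> A \<I>) \<otimes> \<one> \<I>) = \<sigma> A \<I> \<cdot> (\<l> A \<otimes> \<one> \<I>) \<cdot> (\<sigma> A \<I> \<otimes> \<one> \<I>)"
    by (simp add: tensor_merge)
  also have "\<dots> = \<sigma> A \<I> \<cdot> \<l> (A \<odot> \<I>) \<cdot> \<alpha> \<I> A \<I> \<cdot> (\<sigma> A \<I> \<otimes> \<one> \<I>)"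
    by (simp add: comp_extend[OF lunit_tensor])
  also have "\<dots> = \<sigma> A \<I> \<cdot> \<l> (A \<odot> \<I>) \<cdot> swap_at A \<I> \<I> \<cdot> \<alpha> A \<I> \<I>"
    by (simp add: swap_at_assoc)
  also have "\<dots> = \<l> (\<I> \<odot> A) \<cdot> (\<one> \<I> \<otimes> \<sigma> A \<I>) \<cdot> swap_at A \<I> \<I> \<cdot> \<alpha> A \<I> \<I>"
    by (simp add: comp_extend[OF lunit_natural_arr] comp_assoc_arr)
  also have "\<dots> = \<l> (\<I> \<odot> A) \<cdot> \<alpha> \<I> \<I> A \<cdot> \<sigma> A (\<I> \<odot> \<I>) \<cdot> \<alpha> A \<I> \<I>"
    by (simp add: comp_extend[OF swap_tensor_right] comp_assoc_arr)
  also have "\<dots> = (\<l> \<I> \<otimes> \<one> A) \<cdot> \<sigma> A (\<I> \<odot> \<I>) \<cdot> \<alpha> A \<I> \<I>"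
    by (simp add: comp_extend[OF lunit_tensor])
  also have "\<dots> = \<sigma> A \<I> \<cdot> (\<one> A \<otimes> \<l> \<I>) \<cdot> \<alpha> A \<I> \<I>"
    by (simp add: comp_extend[OF swap_natural_arr] comp_assoc_arr)
  also have "\<dots> = \<sigma> A \<I> \<cdot> (\<r> A \<otimes> \<one> \<I>)"
    by (simp add: triangle)
  finally show "(\<l> A \<cdot> \<sigma> A \<I>) \<otimes> \<one> \<I> = \<r> A \<otimes> \<one> \<I>"
    by (rule iso_cancel_left[rotated]) simp_all
qed simp_all

lemma runit_swap:
  assumes [simp]: "A \<in> Ob"
  shows "\<r> A \<cdot> \<sigma> \<I> A = \<l> A"
  by (simp add: lunit_swap[symmetric] comp_assoc_arr)

lemma swap_unit: "\<sigma> \<I> \<I> = \<one> (\<I> \<odot> \<I>)"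
proof (rule iso_cancel_left[of "\<l> \<I>"])
  show "\<l> \<I> \<cdot> \<sigma> \<I> \<I> = \<l> \<I> \<cdot> \<one> (\<I> \<odot> \<I>)"
    using lunit_swap[of \<I>] lunit_unit by simp
qed simp_all

end


section \<open>Coherence of the middle-four interchange\<close>

context symmetric_monoidal_category
begin

lemma interchange_swap_at:
  assumes "A \<in> Ob" "A' \<in> Ob" "B \<in> Ob" "B' \<in> Ob"
  shows "interchange C A A' B B'
    = \<alpha>\<^sup>- A B (A' \<odot> B') \<cdot> (\<one> A \<otimes> swap_at A' B B') \<cdot> \<alpha> A A' (B \<odot> B')"
  by (simp add: interchange_def swap_at_def)

lemma interchange_typing [simp]:
  assumes "A \<in> Ob" "A' \<in> Ob" "B \<in> Ob" "B' \<in> Ob"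
  shows "arr (interchange C A A' B B')"
    "src (interchange C A A' B B') = (A \<odot> A') \<odot> (B \<odot> B')"
    "tgt (interchange C A A' B B') = (A \<odot> B) \<odot> (A' \<odot> B')"
  using assms by (simp_all add: interchange_swap_at)

lemma assoc_interchange:
  assumes "A \<in> Ob" "A' \<in> Ob" "B \<in> Ob" "B' \<in> Ob"
  shows "\<alpha> A B (A' \<odot> B') \<cdot> interchange C A A' B B'
    = (\<one> A \<otimes> swap_at A' B B') \<cdot> \<alpha> A A' (B \<odot> B')"
  using assms by (simp add: interchange_swap_at)

lemma interchange_natural:
  assumes [simp]: "arr f" "arr f'" "arr g" "arr g'"
    and "A = tgt f" "A' = tgt f'" "B = tgt g" "B' = tgt g'"
  shows "interchange C A A' B B' \<cdot> ((f \<otimes> f') \<otimes> (g \<otimes> g'))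
    = ((f \<otimes> g) \<otimes> (f' \<otimes> g')) \<cdot> interchange C (src f) (src f') (src g) (src g')"
    (is "?l = ?r")
proof -
  have [simp]: "A = tgt f" "A' = tgt f'" "B = tgt g" "B' = tgt g'" by fact+
  have "\<alpha> A B (A' \<odot> B') \<cdot> ?l
      = (\<one> A \<otimes> swap_at A' B B') \<cdot> \<alpha> A A' (B \<odot> B') \<cdot> ((f \<otimes> f') \<otimes> (g \<otimes> g'))"
    by (simp add: comp_extend[OF assoc_interchange] comp_assoc_arr)
  also have "\<dots> = (\<one> A \<otimes> swap_at A' B B') \<cdot> (f \<otimes> (f' \<otimes> (g \<otimes> g')))
      \<cdot> \<alpha> (src f) (src f') (src g \<odot> src g')"
    by (simp add: assoc_natural_arr)
  also have "\<dots> = (f \<otimes> (g \<otimes> (f' \<otimes> g'))) \<cdot> (\<one> (src f) \<otimes> swap_at (src f') (src g) (src g'))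
      \<cdot> \<alpha> (src f) (src f') (src g \<odot> src g')"
    by (simp add: tensor_merge swap_at_natural)
  also have "\<dots> = (f \<otimes> (g \<otimes> (f' \<otimes> g'))) \<cdot> \<alpha> (src f) (src g) (src f' \<odot> src g')
      \<cdot> interchange C (src f) (src f') (src g) (src g')"
    by (simp add: assoc_interchange)
  also have "\<dots> = \<alpha> A B (A' \<odot> B') \<cdot> ?r"
    by (simp add: comp_extend[OF assoc_natural_arr] comp_assoc_arr)
  finally show ?thesis
    by (rule iso_cancel_left[rotated]) simp_all
qed

text \<open>
  Both sides rearrange \<open>a b c x y z\<close> into \<open>a x b y c z\<close>, so they move \<open>c\<close> past \<open>x\<close> and \<open>y\<close>, and \<open>b\<close> past
  \<open>x\<close>. On the left \<open>c\<close> passes \<open>x\<close> and \<open>y\<close> before \<open>b\<close> passes \<open>x\<close>; on the right \<open>b\<close> and \<open>c\<close> first pass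
  \<open>x\<close>, and \<open>c\<close> passes \<open>y\<close> afterwards. The two orders agree because the exchange of \<open>b\<close> and \<open>x\<close> is
  natural in the remaining factors, among which \<open>c\<close> and \<open>y\<close> are exchanged.
\<close>
lemma interchange_assoc:
  assumes [simp]: "a \<in> Ob" "b \<in> Ob" "c \<in> Ob" "x \<in> Ob" "y \<in> Ob" "z \<in> Ob"
  shows "\<alpha> (a \<odot> x) (b \<odot> y) (c \<odot> z) \<cdot> (interchange C a b x y \<otimes> \<one> (c \<odot> z))
      \<cdot> interchange C (a \<odot> b) c (x \<odot> y) z
    = (\<one> (a \<odot> x) \<otimes> interchange C b c y z) \<cdot> interchange C a (b \<odot> c) x (y \<odot> z)
      \<cdot> (\<alpha> a b c \<otimes> \<alpha> x y z)"
    (is "?l = ?r")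
proof -
  \<comment> \<open>\<open>?k\<close> and \<open>?h\<close> move the brackets of the common target to the right. Both sides then become the
    exchanges \<open>?q\<close> after the rebracketing \<open>?p\<close> of the common source.\<close>
  let ?k = "\<alpha> a x ((b \<odot> y) \<odot> (c \<odot> z))" and ?h = "\<one> a \<otimes> (\<one> x \<otimes> \<alpha> b y (c \<odot> z))"
  let ?m = "interchange C (a \<odot> b) c (x \<odot> y) z"
  let ?q = "swap_at b x (y \<odot> (c \<odot> z)) \<cdot> (\<one> b \<otimes> ((\<one> x \<otimes> swap_at c y z) \<cdot> swap_at c x (y \<odot> z)))"
  let ?p = "\<alpha> a b (c \<odot> (x \<odot> (y \<odot> z))) \<cdot> \<alpha> (a \<odot> b) c (x \<odot> (y \<odot> z)) \<cdot> (\<one> ((a \<odot> b) \<odot> c) \<otimes> \<alpha> x y z)"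
  have "?k \<cdot> ?l = (\<one> a \<otimes> \<alpha> x (b \<odot> y) (c \<odot> z)) \<cdot> \<alpha> a (x \<odot> (b \<odot> y)) (c \<odot> z)
      \<cdot> (\<alpha> a x (b \<odot> y) \<otimes> \<one> (c \<odot> z)) \<cdot> (interchange C a b x y \<otimes> \<one> (c \<odot> z)) \<cdot> ?m"
    by (simp add: comp_extend[OF pentagon] comp_assoc_arr)
  also have "\<dots> = (\<one> a \<otimes> \<alpha> x (b \<odot> y) (c \<odot> z)) \<cdot> \<alpha> a (x \<odot> (b \<odot> y)) (c \<odot> z)
      \<cdot> ((\<one> a \<otimes> swap_at b x y) \<otimes> \<one> (c \<odot> z)) \<cdot> (\<alpha> a b (x \<odot> y) \<otimes> \<one> (c \<odot> z)) \<cdot> ?m"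
    by (simp add: tensor_merge assoc_interchange)
  also have "\<dots> = (\<one> a \<otimes> \<alpha> x (b \<odot> y) (c \<odot> z)) \<cdot> (\<one> a \<otimes> (swap_at b x y \<otimes> \<one> (c \<odot> z)))
      \<cdot> \<alpha> a (b \<odot> (x \<odot> y)) (c \<odot> z) \<cdot> (\<alpha> a b (x \<odot> y) \<otimes> \<one> (c \<odot> z)) \<cdot> ?m"
    by (simp add: comp_extend[OF assoc_natural_arr] comp_assoc_arr)
  finally have "?h \<cdot> ?k \<cdot> ?l
      = (\<one> a \<otimes> ((\<one> x \<otimes> \<alpha> b y (c \<odot> z)) \<cdot> \<alpha> x (b \<odot> y) (c \<odot> z) \<cdot> (swap_at b x y \<otimes> \<one> (c \<odot> z))))
      \<cdot> \<alpha> a (b \<odot> (x \<odot> y)) (c \<odot> z) \<cdot> (\<alpha> a b (x \<odot> y) \<otimes> \<one> (c \<odot> z)) \<cdot> ?m"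
    by (simp add: tensor_merge)
  also have "\<dots> = (\<one> a \<otimes> (swap_at b x (y \<odot> (c \<odot> z)) \<cdot> (\<one> b \<otimes> \<alpha> x y (c \<odot> z))))
      \<cdot> (\<one> a \<otimes> \<alpha> b (x \<odot> y) (c \<odot> z)) \<cdot> \<alpha> a (b \<odot> (x \<odot> y)) (c \<odot> z)
      \<cdot> (\<alpha> a b (x \<odot> y) \<otimes> \<one> (c \<odot> z)) \<cdot> ?m"
    by (simp add: swap_at_tensor tensor_merge comp_assoc_arr)
  also have "\<dots> = (\<one> a \<otimes> (swap_at b x (y \<odot> (c \<odot> z)) \<cdot> (\<one> b \<otimes> \<alpha> x y (c \<odot> z))))
      \<cdot> ((\<one> a \<otimes> \<alpha> b (x \<odot> y) (c \<odot> z)) \<cdot> \<alpha> a (b \<odot> (x \<odot> y)) (c \<odot> z)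
      \<cdot> (\<alpha> a b (x \<odot> y) \<otimes> \<one> (c \<odot> z))) \<cdot> ?m"
    by (simp add: comp_assoc_arr)
  also have "\<dots> = (\<one> a \<otimes> (swap_at b x (y \<odot> (c \<odot> z)) \<cdot> (\<one> b \<otimes> \<alpha> x y (c \<odot> z))))
      \<cdot> \<alpha> a b ((x \<odot> y) \<odot> (c \<odot> z)) \<cdot> \<alpha> (a \<odot> b) (x \<odot> y) (c \<odot> z) \<cdot> ?m"
    by (simp add: pentagon[symmetric] comp_assoc_arr)
  also have "\<dots> = (\<one> a \<otimes> (swap_at b x (y \<odot> (c \<odot> z)) \<cdot> (\<one> b \<otimes> \<alpha> x y (c \<odot> z))))
      \<cdot> \<alpha> a b ((x \<odot> y) \<odot> (c \<odot> z)) \<cdot> ((\<one> a \<otimes> \<one> b) \<otimes> swap_at c (x \<odot> y) z) \<cdot> \<alpha> (a \<odot> b) c ((x \<odot> y) \<odot> z)"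
    by (simp add: assoc_interchange)
  also have "\<dots> = (\<one> a \<otimes> (swap_at b x (y \<odot> (c \<odot> z)) \<cdot> (\<one> b \<otimes> \<alpha> x y (c \<odot> z))))
      \<cdot> (\<one> a \<otimes> (\<one> b \<otimes> swap_at c (x \<odot> y) z)) \<cdot> \<alpha> a b (c \<odot> ((x \<odot> y) \<odot> z)) \<cdot> \<alpha> (a \<odot> b) c ((x \<odot> y) \<odot> z)"
    by (simp add: comp_extend[OF assoc_natural_arr] comp_assoc_arr del: tensor_id)
  also have "\<dots> = (\<one> a \<otimes> ?q) \<cdot> (\<one> a \<otimes> (\<one> b \<otimes> (\<one> c \<otimes> \<alpha> x y z)))
      \<cdot> \<alpha> a b (c \<odot> ((x \<odot> y) \<odot> z)) \<cdot> \<alpha> (a \<odot> b) c ((x \<odot> y) \<odot> z)"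
    by (simp add: tensor_merge comp_assoc_arr swap_at_tensor_right)
  also have "\<dots> = (\<one> a \<otimes> ?q) \<cdot> \<alpha> a b (c \<odot> (x \<odot> (y \<odot> z)))
      \<cdot> ((\<one> a \<otimes> \<one> b) \<otimes> (\<one> c \<otimes> \<alpha> x y z)) \<cdot> \<alpha> (a \<odot> b) c ((x \<odot> y) \<odot> z)"
    by (simp add: comp_extend[OF assoc_natural_arr] comp_assoc_arr del: tensor_id)
  also have "\<dots> = (\<one> a \<otimes> ?q) \<cdot> \<alpha> a b (c \<odot> (x \<odot> (y \<odot> z)))
      \<cdot> \<alpha> (a \<odot> b) c (x \<odot> (y \<odot> z)) \<cdot> ((\<one> (a \<odot> b) \<otimes> \<one> c) \<otimes> \<alpha> x y z)"
    by (simp add: assoc_natural_arr del: tensor_id) simp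
  finally have left: "?h \<cdot> ?k \<cdot> ?l = (\<one> a \<otimes> ?q) \<cdot> ?p"
    by simp
  have "?k \<cdot> ?r = ?k \<cdot> ((\<one> a \<otimes> \<one> x) \<otimes> interchange C b c y z) \<cdot> interchange C a (b \<odot> c) x (y \<odot> z)
      \<cdot> (\<alpha> a b c \<otimes> \<alpha> x y z)"
    by simp
  also have "\<dots> = (\<one> a \<otimes> (\<one> x \<otimes> interchange C b c y z)) \<cdot> \<alpha> a x ((b \<odot> c) \<odot> (y \<odot> z))
      \<cdot> interchange C a (b \<odot> c) x (y \<odot> z) \<cdot> (\<alpha> a b c \<otimes> \<alpha> x y z)"
    by (simp add: comp_extend[OF assoc_natural_arr] comp_assoc_arr del: tensor_id)
  also have "\<dots> = (\<one> a \<otimes> (\<one> x \<otimes> interchange C b c y z)) \<cdot> (\<one> a \<otimes> swap_at (b \<odot> c) x (y \<odot> z))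
      \<cdot> \<alpha> a (b \<odot> c) (x \<odot> (y \<odot> z)) \<cdot> (\<alpha> a b c \<otimes> \<alpha> x y z)"
    by (simp add: comp_extend[OF assoc_interchange] comp_assoc_arr)
  finally have "?h \<cdot> ?k \<cdot> ?r = (\<one> a \<otimes> ((\<one> x \<otimes> (\<alpha> b y (c \<odot> z) \<cdot> interchange C b c y z))
      \<cdot> swap_at (b \<odot> c) x (y \<odot> z))) \<cdot> \<alpha> a (b \<odot> c) (x \<odot> (y \<odot> z)) \<cdot> (\<alpha> a b c \<otimes> \<alpha> x y z)"
    by (simp add: tensor_merge comp_assoc_arr)
  also have "\<dots> = (\<one> a \<otimes> ((\<one> x \<otimes> (\<one> b \<otimes> swap_at c y z)) \<cdot> ((\<one> x \<otimes> \<alpha> b c (y \<odot> z))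
      \<cdot> swap_at (b \<odot> c) x (y \<odot> z)))) \<cdot> \<alpha> a (b \<odot> c) (x \<odot> (y \<odot> z)) \<cdot> (\<alpha> a b c \<otimes> \<alpha> x y z)"
    by (simp add: tensor_merge assoc_interchange)
  also have "\<dots> = (\<one> a \<otimes> (((\<one> x \<otimes> (\<one> b \<otimes> swap_at c y z)) \<cdot> swap_at b x (c \<odot> (y \<odot> z)))
      \<cdot> (\<one> b \<otimes> swap_at c x (y \<odot> z)) \<cdot> \<alpha> b c (x \<odot> (y \<odot> z))))
      \<cdot> \<alpha> a (b \<odot> c) (x \<odot> (y \<odot> z)) \<cdot> (\<alpha> a b c \<otimes> \<alpha> x y z)"
    by (simp add: swap_at_tensor_left comp_assoc_arr)
  also have "(\<one> x \<otimes> (\<one> b \<otimes> swap_at c y z)) \<cdot> swap_at b x (c \<odot> (y \<odot> z))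
      = swap_at b x (y \<odot> (c \<odot> z)) \<cdot> (\<one> b \<otimes> (\<one> x \<otimes> swap_at c y z))"
    by (simp add: swap_at_natural)
  also have "(\<one> a \<otimes> ((swap_at b x (y \<odot> (c \<odot> z)) \<cdot> (\<one> b \<otimes> (\<one> x \<otimes> swap_at c y z)))
      \<cdot> (\<one> b \<otimes> swap_at c x (y \<odot> z)) \<cdot> \<alpha> b c (x \<odot> (y \<odot> z))))
      \<cdot> \<alpha> a (b \<odot> c) (x \<odot> (y \<odot> z)) \<cdot> (\<alpha> a b c \<otimes> \<alpha> x y z)
    = (\<one> a \<otimes> ?q) \<cdot> ((\<one> a \<otimes> \<alpha> b c (x \<odot> (y \<odot> z))) \<cdot> \<alpha> a (b \<odot> c) (x \<odot> (y \<odot> z))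
      \<cdot> (\<alpha> a b c \<otimes> \<one> (x \<odot> (y \<odot> z)))) \<cdot> (\<one> ((a \<odot> b) \<odot> c) \<otimes> \<alpha> x y z)"
    by (simp add: tensor_merge comp_assoc_arr)
  also have "\<dots> = (\<one> a \<otimes> ?q) \<cdot> ?p"
    by (simp add: pentagon[symmetric] comp_assoc_arr)
  finally have right: "?h \<cdot> ?k \<cdot> ?r = (\<one> a \<otimes> ?q) \<cdot> ?p" .
  have "?h \<cdot> ?k \<cdot> ?l = ?h \<cdot> ?k \<cdot> ?r"
    unfolding left right ..
  then have "?k \<cdot> ?l = ?k \<cdot> ?r"
    by (rule iso_cancel_left[rotated]) simp_all
  then show ?thesis
    by (rule iso_cancel_left[rotated]) simp_all
qed

text \<open>
  The symmetry on the left moves \<open>A\<close> and \<open>B\<close> past \<open>A'\<close> and \<open>B'\<close>. In particular it moves \<open>B\<close> past \<open>A'\<close>,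
  which cancels the exchange of \<open>A'\<close> and \<open>B\<close> in the interchange. The exchanges left over are
  \<open>\<sigma> A A'\<close>, \<open>\<sigma> B B'\<close> and that of \<open>A\<close> and \<open>B'\<close>, which is the interchange on the right.
\<close>
lemma interchange_swap:
  assumes [simp]: "A \<in> Ob" "A' \<in> Ob" "B \<in> Ob" "B' \<in> Ob"
  shows "\<sigma> (A \<odot> B) (A' \<odot> B') \<cdot> interchange C A A' B B'
    = interchange C A' A B' B \<cdot> (\<sigma> A A' \<otimes> \<sigma> B B')"
    (is "?l = ?r")
proof -
  have "?l = swap_at A (A' \<odot> B') B \<cdot> (\<one> A \<otimes> (\<sigma> B (A' \<odot> B') \<cdot> swap_at A' B B')) \<cdot> \<alpha> A A' (B \<odot> B')"
    by (simp add: swap_tensor_left[of A B] assoc_interchange comp_assoc_arr tensor_merge)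
  then have "\<alpha> A' B' (A \<odot> B) \<cdot> ?l = (\<alpha> A' B' (A \<odot> B) \<cdot> swap_at A (A' \<odot> B') B)
      \<cdot> (\<one> A \<otimes> (\<sigma> B (A' \<odot> B') \<cdot> swap_at A' B B')) \<cdot> \<alpha> A A' (B \<odot> B')"
    by (simp add: comp_assoc_arr)
  also have "\<dots> = (\<one> A' \<otimes> swap_at A B' B) \<cdot> swap_at A A' (B' \<odot> B)
      \<cdot> (\<one> A \<otimes> ((\<alpha> A' B' B \<cdot> \<sigma> B (A' \<odot> B')) \<cdot> swap_at A' B B')) \<cdot> \<alpha> A A' (B \<odot> B')"
    by (simp add: swap_at_tensor_right comp_assoc_arr tensor_merge)
  also have "(\<alpha> A' B' B \<cdot> \<sigma> B (A' \<odot> B')) \<cdot> swap_at A' B B' = \<one> A' \<otimes> \<sigma> B B'"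
    by (simp add: swap_tensor_right comp_assoc_arr)
  also have "(\<one> A' \<otimes> swap_at A B' B) \<cdot> swap_at A A' (B' \<odot> B) \<cdot> (\<one> A \<otimes> (\<one> A' \<otimes> \<sigma> B B')) \<cdot> \<alpha> A A' (B \<odot> B')
      = (\<one> A' \<otimes> swap_at A B' B) \<cdot> swap_at A A' (B' \<odot> B) \<cdot> \<alpha> A A' (B' \<odot> B) \<cdot> ((\<one> A \<otimes> \<one> A') \<otimes> \<sigma> B B')"
    by (simp add: assoc_natural_arr del: tensor_id)
  also have "\<dots> = (\<one> A' \<otimes> swap_at A B' B) \<cdot> \<alpha> A' A (B' \<odot> B) \<cdot> (\<sigma> A A' \<otimes> \<sigma> B B')"
    by (simp add: comp_extend[OF swap_at_assoc] comp_assoc_arr tensor_merge)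
  also have "\<dots> = \<alpha> A' B' (A \<odot> B) \<cdot> ?r"
    by (simp add: comp_extend[OF assoc_interchange] comp_assoc_arr)
  finally show ?thesis
    by (rule iso_cancel_left[rotated]) simp_all
qed

text \<open>
  The interchange only moves \<open>A\<close> past a unit object, and \<open>lunit_swap\<close> absorbs that exchange into a
  unit isomorphism.
\<close>
lemma interchange_lunit:
  assumes [simp]: "A \<in> Ob" "B \<in> Ob"
  shows "\<l> (A \<odot> B) \<cdot> (\<l> \<I> \<otimes> \<one> (A \<odot> B)) \<cdot> interchange C \<I> A \<I> B = \<l> A \<otimes> \<l> B"
proof -
  have "(\<l> (A \<odot> B) \<cdot> swap_at A \<I> B) \<cdot> \<alpha> A \<I> B = ((\<l> A \<cdot> \<sigma> A \<I>) \<otimes> \<one> B)"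
    by (simp add: swap_at_assoc comp_assoc_arr comp_extend[OF lunit_tensor] tensor_merge)
  also have "\<dots> = (\<one> A \<otimes> \<l> B) \<cdot> \<alpha> A \<I> B"
    by (simp add: lunit_swap triangle)
  finally have swap_unit_factor: "\<l> (A \<odot> B) \<cdot> swap_at A \<I> B = \<one> A \<otimes> \<l> B"
    by (rule iso_cancel_right[rotated]) simp_all
  have "\<l> (A \<odot> B) \<cdot> (\<l> \<I> \<otimes> \<one> (A \<odot> B)) \<cdot> interchange C \<I> A \<I> B
      = \<l> (A \<odot> B) \<cdot> (\<one> \<I> \<otimes> \<l> (A \<odot> B)) \<cdot> \<alpha> \<I> \<I> (A \<odot> B) \<cdot> interchange C \<I> A \<I> B"
    by (simp add: comp_extend[OF triangle] lunit_unit)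
  also have "\<dots> = \<l> (A \<odot> B) \<cdot> (\<one> \<I> \<otimes> (\<l> (A \<odot> B) \<cdot> swap_at A \<I> B)) \<cdot> \<alpha> \<I> A (\<I> \<odot> B)"
    by (simp add: assoc_interchange tensor_merge)
  also have "\<dots> = (\<one> A \<otimes> \<l> B) \<cdot> \<l> (A \<odot> (\<I> \<odot> B)) \<cdot> \<alpha> \<I> A (\<I> \<odot> B)"
    by (simp add: swap_unit_factor comp_extend[OF lunit_natural_arr] comp_assoc_arr)
  also have "\<dots> = \<l> A \<otimes> \<l> B"
    by (simp add: lunit_tensor tensor_merge)
  finally show ?thesis .
qed

lemma interchange_runit:
  assumes [simp]: "A \<in> Ob" "B \<in> Ob"
  shows "\<r> (A \<odot> B) \<cdot> (\<one> (A \<odot> B) \<otimes> \<l> \<I>) \<cdot> interchange C A \<I> B \<I> = \<r> A \<otimes> \<r> B"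
proof -
  have "((\<one> B \<otimes> \<l> \<I>) \<cdot> swap_at \<I> B \<I>) \<cdot> \<alpha> \<I> B \<I> = (\<r> B \<cdot> \<sigma> \<I> B) \<otimes> \<one> \<I>"
    by (simp add: swap_at_assoc comp_assoc_arr comp_extend[OF triangle] tensor_merge)
  also have "\<dots> = \<l> (B \<odot> \<I>) \<cdot> \<alpha> \<I> B \<I>"
    by (simp add: runit_swap lunit_tensor)
  finally have swap_unit_factor: "(\<one> B \<otimes> \<l> \<I>) \<cdot> swap_at \<I> B \<I> = \<l> (B \<odot> \<I>)"
    by (rule iso_cancel_right[rotated]) simp_all
  have "\<r> (A \<odot> B) \<cdot> (\<one> (A \<odot> B) \<otimes> \<l> \<I>) \<cdot> interchange C A \<I> B \<I>
      = (\<one> A \<otimes> \<r> B) \<cdot> \<alpha> A B \<I> \<cdot> ((\<one> A \<otimes> \<one> B) \<otimes> \<l> \<I>) \<cdot> interchange C A \<I> B \<I>"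
    by (simp add: comp_extend[OF runit_tensor])
  also have "\<dots> = (\<one> A \<otimes> \<r> B) \<cdot> (\<one> A \<otimes> (\<one> B \<otimes> \<l> \<I>)) \<cdot> \<alpha> A B (\<I> \<odot> \<I>) \<cdot> interchange C A \<I> B \<I>"
    by (simp add: comp_extend[OF assoc_natural_arr] comp_assoc_arr del: tensor_id)
  also have "\<dots> = (\<one> A \<otimes> \<r> B) \<cdot> (\<one> A \<otimes> \<l> (B \<odot> \<I>)) \<cdot> \<alpha> A \<I> (B \<odot> \<I>)"
    by (simp add: assoc_interchange tensor_merge swap_unit_factor)
  also have "\<dots> = \<r> A \<otimes> \<r> B"
    by (simp add: triangle tensor_merge)
  finally show ?thesis .
qed


section \<open>Tensor products of comonoids\<close>

lemma comonoidD:
  assumes "comonoid C A \<mu> \<epsilon>"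
  shows "A \<in> Ob" "arr \<mu>" "src \<mu> = A" "tgt \<mu> = A \<odot> A" "arr \<epsilon>" "src \<epsilon> = A" "tgt \<epsilon> = \<I>"
    "\<alpha> A A A \<cdot> (\<mu> \<otimes> \<one> A) \<cdot> \<mu> = (\<one> A \<otimes> \<mu>) \<cdot> \<mu>"
    "\<l> A \<cdot> (\<epsilon> \<otimes> \<one> A) \<cdot> \<mu> = \<one> A"
    "\<r> A \<cdot> (\<one> A \<otimes> \<epsilon>) \<cdot> \<mu> = \<one> A"
  using assms by (simp_all add: comonoid_def in_hom_iff)

text \<open>
  In each law, naturality moves the interchange to the left of all comultiplications and counits.
  What stands on its right is a tensor product of one side of the law for each factor, and what
  stands on its left is treated by the compatibility of the interchange with \<open>\<alpha>\<close>, \<open>\<l>\<close> or \<open>\<r>\<close>.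
\<close>
lemma comonoid_tensor:
  assumes "comonoid C A \<mu> \<epsilon>" "comonoid C B \<nu> \<delta>"
  shows "comonoid C (A \<odot> B) (tensor_copy C A \<mu> B \<nu>) (tensor_del C \<epsilon> \<delta>)"
proof -
  note A [simp] = comonoidD(1-7)[OF assms(1)]
  note B [simp] = comonoidD(1-7)[OF assms(2)]
  let ?copy = "tensor_copy C A \<mu> B \<nu>" and ?del = "tensor_del C \<epsilon> \<delta>"
  let ?m = "interchange C A A B B"
  have typing [simp]: "arr ?copy" "src ?copy = A \<odot> B" "tgt ?copy = (A \<odot> B) \<odot> (A \<odot> B)"
    "arr ?del" "src ?del = A \<odot> B" "tgt ?del = \<I>"
    by (simp_all add: tensor_copy_def tensor_del_def)
  have "(?copy \<otimes> \<one> (A \<odot> B)) \<cdot> ?copy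
      = (?m \<otimes> \<one> (A \<odot> B)) \<cdot> ((\<mu> \<otimes> \<nu>) \<otimes> (\<one> A \<otimes> \<one> B)) \<cdot> ?m \<cdot> (\<mu> \<otimes> \<nu>)"
    by (simp add: tensor_copy_def tensor_merge)
  also have "((\<mu> \<otimes> \<nu>) \<otimes> (\<one> A \<otimes> \<one> B)) \<cdot> ?m \<cdot> (\<mu> \<otimes> \<nu>)
      = interchange C (A \<odot> A) A (B \<odot> B) B \<cdot> ((\<mu> \<otimes> \<one> A) \<otimes> (\<nu> \<otimes> \<one> B)) \<cdot> (\<mu> \<otimes> \<nu>)"
    by (simp add: comp_extend[OF interchange_natural] comp_assoc_arr del: tensor_id)
  finally have "\<alpha> (A \<odot> B) (A \<odot> B) (A \<odot> B) \<cdot> (?copy \<otimes> \<one> (A \<odot> B)) \<cdot> ?copy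
      = (\<alpha> (A \<odot> B) (A \<odot> B) (A \<odot> B) \<cdot> (?m \<otimes> \<one> (A \<odot> B)) \<cdot> interchange C (A \<odot> A) A (B \<odot> B) B)
        \<cdot> ((\<mu> \<otimes> \<one> A) \<otimes> (\<nu> \<otimes> \<one> B)) \<cdot> (\<mu> \<otimes> \<nu>)"
    by (simp add: comp_assoc_arr)
  also have "\<dots> = (\<one> (A \<odot> B) \<otimes> ?m) \<cdot> interchange C A (A \<odot> A) B (B \<odot> B)
      \<cdot> ((\<alpha> A A A \<cdot> (\<mu> \<otimes> \<one> A) \<cdot> \<mu>) \<otimes> (\<alpha> B B B \<cdot> (\<nu> \<otimes> \<one> B) \<cdot> \<nu>))"
    by (simp add: interchange_assoc comp_assoc_arr tensor_merge)
  also have "\<dots> = (\<one> (A \<odot> B) \<otimes> ?m) \<cdot> interchange C A (A \<odot> A) B (B \<odot> B)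
      \<cdot> ((\<one> A \<otimes> \<mu>) \<otimes> (\<one> B \<otimes> \<nu>)) \<cdot> (\<mu> \<otimes> \<nu>)"
    by (simp add: comonoidD(8)[OF assms(1)] comonoidD(8)[OF assms(2)] tensor_merge)
  also have "interchange C A (A \<odot> A) B (B \<odot> B) \<cdot> ((\<one> A \<otimes> \<mu>) \<otimes> (\<one> B \<otimes> \<nu>)) \<cdot> (\<mu> \<otimes> \<nu>)
      = ((\<one> A \<otimes> \<one> B) \<otimes> (\<mu> \<otimes> \<nu>)) \<cdot> ?m \<cdot> (\<mu> \<otimes> \<nu>)"
    by (simp add: comp_extend[OF interchange_natural] comp_assoc_arr del: tensor_id)
  also have "(\<one> (A \<odot> B) \<otimes> ?m) \<cdot> ((\<one> A \<otimes> \<one> B) \<otimes> (\<mu> \<otimes> \<nu>)) \<cdot> ?m \<cdot> (\<mu> \<otimes> \<nu>)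
      = (\<one> (A \<odot> B) \<otimes> ?copy) \<cdot> ?copy"
    by (simp add: tensor_copy_def tensor_merge)
  finally have coassoc: "\<alpha> (A \<odot> B) (A \<odot> B) (A \<odot> B) \<cdot> (?copy \<otimes> \<one> (A \<odot> B)) \<cdot> ?copy
      = (\<one> (A \<odot> B) \<otimes> ?copy) \<cdot> ?copy" .
  have "\<l> (A \<odot> B) \<cdot> (?del \<otimes> \<one> (A \<odot> B)) \<cdot> ?copy
      = \<l> (A \<odot> B) \<cdot> (\<l> \<I> \<otimes> \<one> (A \<odot> B)) \<cdot> ((\<epsilon> \<otimes> \<delta>) \<otimes> (\<one> A \<otimes> \<one> B)) \<cdot> ?m \<cdot> (\<mu> \<otimes> \<nu>)"
    by (simp add: tensor_del_def tensor_copy_def tensor_merge)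
  also have "((\<epsilon> \<otimes> \<delta>) \<otimes> (\<one> A \<otimes> \<one> B)) \<cdot> ?m \<cdot> (\<mu> \<otimes> \<nu>)
      = interchange C \<I> A \<I> B \<cdot> ((\<epsilon> \<otimes> \<one> A) \<otimes> (\<delta> \<otimes> \<one> B)) \<cdot> (\<mu> \<otimes> \<nu>)"
    by (simp add: comp_extend[OF interchange_natural] comp_assoc_arr del: tensor_id)
  also have "\<l> (A \<odot> B) \<cdot> (\<l> \<I> \<otimes> \<one> (A \<odot> B)) \<cdot> interchange C \<I> A \<I> B
        \<cdot> ((\<epsilon> \<otimes> \<one> A) \<otimes> (\<delta> \<otimes> \<one> B)) \<cdot> (\<mu> \<otimes> \<nu>)
      = (\<l> (A \<odot> B) \<cdot> (\<l> \<I> \<otimes> \<one> (A \<odot> B)) \<cdot> interchange C \<I> A \<I> B)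
        \<cdot> ((\<epsilon> \<otimes> \<one> A) \<otimes> (\<delta> \<otimes> \<one> B)) \<cdot> (\<mu> \<otimes> \<nu>)"
    by (simp add: comp_assoc_arr)
  also have "\<dots> = \<one> (A \<odot> B)"
    by (simp add: interchange_lunit tensor_merge comonoidD(9)[OF assms(1)] comonoidD(9)[OF assms(2)])
  finally have counit_left: "\<l> (A \<odot> B) \<cdot> (?del \<otimes> \<one> (A \<odot> B)) \<cdot> ?copy = \<one> (A \<odot> B)" .
  have "\<r> (A \<odot> B) \<cdot> (\<one> (A \<odot> B) \<otimes> ?del) \<cdot> ?copy
      = \<r> (A \<odot> B) \<cdot> (\<one> (A \<odot> B) \<otimes> \<l> \<I>) \<cdot> ((\<one> A \<otimes> \<one> B) \<otimes> (\<epsilon> \<otimes> \<delta>)) \<cdot> ?m \<cdot> (\<mu> \<otimes> \<nu>)"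
    by (simp add: tensor_del_def tensor_copy_def tensor_merge)
  also have "((\<one> A \<otimes> \<one> B) \<otimes> (\<epsilon> \<otimes> \<delta>)) \<cdot> ?m \<cdot> (\<mu> \<otimes> \<nu>)
      = interchange C A \<I> B \<I> \<cdot> ((\<one> A \<otimes> \<epsilon>) \<otimes> (\<one> B \<otimes> \<delta>)) \<cdot> (\<mu> \<otimes> \<nu>)"
    by (simp add: comp_extend[OF interchange_natural] comp_assoc_arr del: tensor_id)
  also have "\<r> (A \<odot> B) \<cdot> (\<one> (A \<odot> B) \<otimes> \<l> \<I>) \<cdot> interchange C A \<I> B \<I>
        \<cdot> ((\<one> A \<otimes> \<epsilon>) \<otimes> (\<one> B \<otimes> \<delta>)) \<cdot> (\<mu> \<otimes> \<nu>)
      = (\<r> (A \<odot> B) \<cdot> (\<one> (A \<odot> B) \<otimes> \<l> \<I>) \<cdot> interchange C A \<I> B \<I>)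
        \<cdot> ((\<one> A \<otimes> \<epsilon>) \<otimes> (\<one> B \<otimes> \<delta>)) \<cdot> (\<mu> \<otimes> \<nu>)"
    by (simp add: comp_assoc_arr)
  also have "\<dots> = \<one> (A \<odot> B)"
    by (simp add: interchange_runit tensor_merge comonoidD(10)[OF assms(1)] comonoidD(10)[OF assms(2)])
  finally have counit_right: "\<r> (A \<odot> B) \<cdot> (\<one> (A \<odot> B) \<otimes> ?del) \<cdot> ?copy = \<one> (A \<odot> B)" .
  show ?thesis
    using coassoc counit_left counit_right by (simp add: comonoid_def in_hom_iff)
qed

text \<open>Coassociativity is the inverse of the triangle for \<open>\<I>, \<I>\<close>, given that \<open>\<l> \<I> = \<r> \<I>\<close>.\<close>
lemma comonoid_unit: "comonoid C \<I> (unit_copy C) (\<one> \<I>)"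
proof -
  let ?u = "inverse_of C (\<l> \<I>)"
  note u [simp] = iso_inverse[OF lunit_iso[OF unit_ob]]
  have "(\<one> \<I> \<otimes> \<l> \<I>) \<cdot> \<alpha> \<I> \<I> \<I> \<cdot> (?u \<otimes> \<one> \<I>) = (\<one> \<I> \<otimes> \<l> \<I>) \<cdot> (\<one> \<I> \<otimes> ?u)"
    by (simp add: comp_extend[OF triangle] tensor_merge flip: lunit_unit)
  then have "\<alpha> \<I> \<I> \<I> \<cdot> (?u \<otimes> \<one> \<I>) = \<one> \<I> \<otimes> ?u"
    by (rule iso_cancel_left[rotated]) simp_all
  then have "\<alpha> \<I> \<I> \<I> \<cdot> (?u \<otimes> \<one> \<I>) \<cdot> ?u = (\<one> \<I> \<otimes> ?u) \<cdot> ?u"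
    by (simp add: comp_extend)
  then show ?thesis
    by (simp add: comonoid_def in_hom_iff unit_copy_def flip: lunit_unit)
qed

end


section \<open>Tensor products of involutive comonoids\<close>

context hom_involutive_smc
begin

interpretation bar: strict_symmetric_monoidal_functor C C "\<lambda>A. A" bar
  by (rule bar_functor)

lemma bar_typing [simp]:
  assumes "arr f"
  shows "arr (bar f)" "src (bar f) = src f" "tgt (bar f) = tgt f"
  using in_homD[OF bar.map_hom[of f "src f" "tgt f"]] assms by (auto simp: in_hom_iff)

lemma bar_comp: "arr f \<Longrightarrow> arr g \<Longrightarrow> tgt f = src g \<Longrightarrow> bar (g \<cdot> f) = bar g \<cdot> bar f"
  using bar.map_comp in_hom_iff by metis

lemma bar_tensor: "arr f \<Longrightarrow> arr g \<Longrightarrow> bar (f \<otimes> g) = bar f \<otimes> bar g"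
  using bar.map_tensor_hom in_hom_iff by metis

lemma bar_bar_arr: "arr f \<Longrightarrow> bar (bar f) = f"
  using bar_bar in_hom_iff by blast

lemma bar_inverse:
  assumes "is_iso C f"
  shows "bar (inverse_of C f) = inverse_of C (bar f)"
proof (rule inverse_of_eq[symmetric, OF inverse_morphismsI])
  note f [simp] = iso_inverse[OF assms]
  show "bar (inverse_of C f) \<cdot> bar f = \<one> (src (bar f))"
    "bar f \<cdot> bar (inverse_of C f) = \<one> (tgt (bar f))"
    by (simp_all add: bar.map_id flip: bar_comp)
qed (use iso_inverse[OF assms] in simp_all)

text \<open>A strict functor that is the identity on objects fixes every structure isomorphism.\<close>
lemma bar_interchange:
  assumes "A \<in> Ob" "A' \<in> Ob" "B \<in> Ob" "B' \<in> Ob"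
  shows "bar (interchange C A A' B B') = interchange C A A' B B'"
  using assms by (simp add: interchange_swap_at swap_at_def bar_comp bar_tensor bar_inverse
      bar.map_id bar.map_assoc bar.map_swap)

lemma involutive_comonoid_tensor:
  assumes "involutive_comonoid C bar A \<mu> \<epsilon>" "involutive_comonoid C bar B \<nu> \<delta>"
  shows "involutive_comonoid C bar (A \<odot> B) (tensor_copy C A \<mu> B \<nu>) (tensor_del C \<epsilon> \<delta>)"
proof -
  have comonoids: "comonoid C A \<mu> \<epsilon>" "comonoid C B \<nu> \<delta>"
    and bars: "bar \<mu> = \<sigma> A A \<cdot> \<mu>" "bar \<nu> = \<sigma> B B \<cdot> \<nu>" "bar \<epsilon> = \<epsilon>" "bar \<delta> = \<delta>"
    using assms by (simp_all add: involutive_comonoid_def)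
  note [simp] = comonoidD(1-7)[OF comonoids(1)] comonoidD(1-7)[OF comonoids(2)]
  have "bar (tensor_copy C A \<mu> B \<nu>) = interchange C A A B B \<cdot> (\<sigma> A A \<otimes> \<sigma> B B) \<cdot> (\<mu> \<otimes> \<nu>)"
    by (simp add: tensor_copy_def bar_comp bar_tensor bar_interchange bars tensor_merge)
  also have "\<dots> = \<sigma> (A \<odot> B) (A \<odot> B) \<cdot> tensor_copy C A \<mu> B \<nu>"
    by (simp add: tensor_copy_def comp_extend[OF interchange_swap] comp_assoc_arr)
  finally show ?thesis
    using comonoid_tensor[OF comonoids]
    by (simp add: involutive_comonoid_def tensor_del_def bar_comp bar_tensor bar.map_lunit bars)
qed

text \<open>
  The comultiplication of the unit comonoid is fixed by the involution, so its compatibility law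
  requires that the symmetry of \<open>\<I>\<close> with itself be trivial.
\<close>
lemma involutive_comonoid_unit: "involutive_comonoid C bar \<I> (unit_copy C) (\<one> \<I>)"
  using iso_inverse[OF lunit_iso[OF unit_ob]] comonoid_unit
  by (simp add: involutive_comonoid_def unit_copy_def bar_inverse bar.map_lunit
      bar.map_id swap_unit)

end


section \<open>The cofree ICD-category\<close>

context hom_involutive_smc
begin

interpretation bar: strict_symmetric_monoidal_functor C C "\<lambda>A. A" bar
  by (rule bar_functor)

abbreviation cofree :: "(('o, 'm) cof_ob, ('o, 'm) cof_hom) smc" where
  "cofree \<equiv> Cof C bar"

lemma cof_simps [simp]:
  "Ob\<^bsub>cofree\<^esub> = cof_obs C bar"
  "\<one>\<^bsub>cofree\<^esub> X = (X, \<one> (carrier_of X), X)"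
  "(Y', g, Z) \<cdot>\<^bsub>cofree\<^esub> (X, f, Y) = (X, g \<cdot> f, Z)"
  "\<I>\<^bsub>cofree\<^esub> = cof_unit C"
  "X \<odot>\<^bsub>cofree\<^esub> Y = cof_tensor C X Y"
  "(X, f, Y) \<otimes>\<^bsub>cofree\<^esub> (X', f', Y') = (cof_tensor C X X', f \<otimes> f', cof_tensor C Y Y')"
  "\<alpha>\<^bsub>cofree\<^esub> X Y Z = (cof_tensor C (cof_tensor C X Y) Z, \<alpha> (carrier_of X) (carrier_of Y) (carrier_of Z),
    cof_tensor C X (cof_tensor C Y Z))"
  "\<l>\<^bsub>cofree\<^esub> X = (cof_tensor C (cof_unit C) X, \<l> (carrier_of X), X)"
  "\<r>\<^bsub>cofree\<^esub> X = (cof_tensor C X (cof_unit C), \<r> (carrier_of X), X)"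
  "\<sigma>\<^bsub>cofree\<^esub> X Y = (cof_tensor C X Y, \<sigma> (carrier_of X) (carrier_of Y), cof_tensor C Y X)"
  by (simp_all add: Cof_def)

lemma cof_hom_iff [simp]:
  "\<phi> \<in> Hom\<^bsub>cofree\<^esub> X Y \<longleftrightarrow> X \<in> cof_obs C bar \<and> Y \<in> cof_obs C bar \<and>
    (\<exists>f. \<phi> = (X, f, Y) \<and> arr f \<and> src f = carrier_of X \<and> tgt f = carrier_of Y)"
  by (auto simp: Cof_def in_hom_iff)

lemma cof_homE:
  assumes "\<phi> \<in> Hom\<^bsub>cofree\<^esub> X Y"
  obtains f where "\<phi> = (X, f, Y)" "X \<in> cof_obs C bar" "Y \<in> cof_obs C bar"
    "arr f" "src f = carrier_of X" "tgt f = carrier_of Y"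
  using assms by auto

lemma carrier_simps [simp]:
  "carrier_of (cof_tensor C X Y) = carrier_of X \<odot> carrier_of Y"
  "carrier_of (cof_unit C) = \<I>"
  by (simp_all add: cof_tensor_def cof_unit_def)

lemma cof_ob_comonoid:
  "X \<in> cof_obs C bar \<Longrightarrow> involutive_comonoid C bar (carrier_of X) (comult_of X) (counit_of X)"
  by (cases X) (simp add: cof_obs_def)

lemma carrier_ob [simp]: "X \<in> cof_obs C bar \<Longrightarrow> carrier_of X \<in> Ob"
  using cof_ob_comonoid by (auto simp: involutive_comonoid_def comonoid_def)

lemma cof_tensor_ob [simp]:
  "X \<in> cof_obs C bar \<Longrightarrow> Y \<in> cof_obs C bar \<Longrightarrow> cof_tensor C X Y \<in> cof_obs C bar"
  using involutive_comonoid_tensor[OF cof_ob_comonoid cof_ob_comonoid]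
  by (simp add: cof_obs_def cof_tensor_def)

lemma cof_unit_ob [simp]: "cof_unit C \<in> cof_obs C bar"
  using involutive_comonoid_unit by (simp add: cof_obs_def cof_unit_def)

text \<open>
  Morphisms of \<open>Cof(C)\<close> need not respect the comonoid structures, so an isomorphism of carriers is
  already an isomorphism of \<open>Cof(C)\<close>, with the same inverse.
\<close>
lemma cof_inverse_morphisms:
  assumes "is_iso C f" "X \<in> cof_obs C bar" "Y \<in> cof_obs C bar"
    "src f = carrier_of X" "tgt f = carrier_of Y"
  shows "inverse_morphisms cofree (X, f, Y) (Y, inverse_of C f, X)"
  unfolding inverse_morphisms_def using assms iso_inverse[OF assms(1)]
  by (intro exI[of _ X] exI[of _ Y]) simp

lemma cof_is_iso:
  assumes "is_iso C f" "X \<in> cof_obs C bar" "Y \<in> cof_obs C bar"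
    "src f = carrier_of X" "tgt f = carrier_of Y"
  shows "is_iso cofree (X, f, Y)"
  unfolding is_iso_def using cof_inverse_morphisms[OF assms] by (rule exI)

lemma category_cof: "category cofree"
  by (unfold_locales; (elim cof_homE)?; simp add: comp_assoc_arr)

lemma cof_inverse_of:
  assumes "is_iso C f" "X \<in> cof_obs C bar" "Y \<in> cof_obs C bar"
    "src f = carrier_of X" "tgt f = carrier_of Y"
  shows "inverse_of cofree (X, f, Y) = (Y, inverse_of C f, X)"
  using category.inverse_of_eq[OF category_cof cof_inverse_morphisms[OF assms]] .

lemma symmetric_monoidal_category_cof: "symmetric_monoidal_category cofree"
proof (rule symmetric_monoidal_category.intro[OF category_cof symmetric_monoidal_category_axioms.intro])
qed ((elim cof_homE)?; simp add: tensor_comp_arr assoc_natural_arr lunit_natural_arr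
    runit_natural_arr swap_natural_arr triangle pentagon hexagon cof_is_iso)+

abbreviation cof_bar :: "('o, 'm) cof_hom \<Rightarrow> ('o, 'm) cof_hom" where
  "cof_bar \<equiv> \<lambda>(X, f, Y). (X, bar f, Y)"

lemma hom_involutive_smc_cof: "hom_involutive_smc cofree cof_bar"
proof (rule hom_involutive_smc.intro[OF symmetric_monoidal_category_cof hom_involutive_smc_axioms.intro])
  show "strict_symmetric_monoidal_functor cofree cofree (\<lambda>A. A) cof_bar"
  proof (rule strict_symmetric_monoidal_functor.intro[OF symmetric_monoidal_category_cof
        symmetric_monoidal_category_cof strict_symmetric_monoidal_functor_axioms.intro])
  qed ((elim cof_homE)?; simp add: bar.map_id bar_comp bar_tensor bar.map_assoc bar.map_lunit
      bar.map_runit bar.map_swap)+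
  show "cof_bar (cof_bar \<phi>) = \<phi>" if "\<phi> \<in> Hom\<^bsub>cofree\<^esub> X Y" for \<phi> X Y
    using that by (elim cof_homE) (simp add: bar_bar_arr)
qed

lemma cof_interchange:
  assumes [simp]: "X \<in> cof_obs C bar" "X' \<in> cof_obs C bar" "Y \<in> cof_obs C bar" "Y' \<in> cof_obs C bar"
  shows "interchange cofree X X' Y Y' = (cof_tensor C (cof_tensor C X X') (cof_tensor C Y Y'),
    interchange C (carrier_of X) (carrier_of X') (carrier_of Y) (carrier_of Y'),
    cof_tensor C (cof_tensor C X Y) (cof_tensor C X' Y'))"
  by (simp add: interchange_def cof_inverse_of)

text \<open>
  The comonoid and involution laws hold by the choice of objects, the laws for tensor products and
  the unit by the choice of the monoidal structure.
\<close>
lemma icd_category_cof: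
  "icd_category cofree cof_bar (\<lambda>X. (X, comult_of X, X \<odot>\<^bsub>cofree\<^esub> X)) (\<lambda>X. (X, counit_of X, \<I>\<^bsub>cofree\<^esub>))"
proof -
  have comonoid: "comonoid C (carrier_of X) (comult_of X) (counit_of X)"
    and bars: "bar (comult_of X) = \<sigma> (carrier_of X) (carrier_of X) \<cdot> comult_of X"
      "bar (counit_of X) = counit_of X"
    if "X \<in> cof_obs C bar" for X
    using cof_ob_comonoid[OF that] by (simp_all add: involutive_comonoid_def)
  show ?thesis
  proof (rule icd_category.intro[OF hom_involutive_smc_cof icd_category_axioms.intro])
    fix X assume "X \<in> Ob\<^bsub>cofree\<^esub>"
    then have [simp]: "X \<in> cof_obs C bar"
      by simp
    show "comonoid cofree X (X, comult_of X, X \<odot>\<^bsub>cofree\<^esub> X) (X, counit_of X, \<I>\<^bsub>cofree\<^esub>)"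
      using comonoidD[OF comonoid[of X]] by (simp add: comonoid_def)
    show "cof_bar (X, comult_of X, X \<odot>\<^bsub>cofree\<^esub> X) = \<sigma>\<^bsub>cofree\<^esub> X X \<cdot>\<^bsub>cofree\<^esub> (X, comult_of X, X \<odot>\<^bsub>cofree\<^esub> X)"
      "cof_bar (X, counit_of X, \<I>\<^bsub>cofree\<^esub>) = (X, counit_of X, \<I>\<^bsub>cofree\<^esub>)"
      by (simp_all add: bars)
    fix Y assume "Y \<in> Ob\<^bsub>cofree\<^esub>"
    then have [simp]: "Y \<in> cof_obs C bar"
      by simp
    show "(X \<odot>\<^bsub>cofree\<^esub> Y, comult_of (X \<odot>\<^bsub>cofree\<^esub> Y), (X \<odot>\<^bsub>cofree\<^esub> Y) \<odot>\<^bsub>cofree\<^esub> (X \<odot>\<^bsub>cofree\<^esub> Y))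
      = tensor_copy cofree X (X, comult_of X, X \<odot>\<^bsub>cofree\<^esub> X) Y (Y, comult_of Y, Y \<odot>\<^bsub>cofree\<^esub> Y)"
      \<comment> \<open>The definition of the product in \<open>Cof(C)\<close> is unfolded last: the lemmas about its objects
        refer to the folded form.\<close>
      by (simp add: tensor_copy_def cof_interchange) (simp add: cof_tensor_def tensor_copy_def)
    show "(X \<odot>\<^bsub>cofree\<^esub> Y, counit_of (X \<odot>\<^bsub>cofree\<^esub> Y), \<I>\<^bsub>cofree\<^esub>)
      = tensor_del cofree (X, counit_of X, \<I>\<^bsub>cofree\<^esub>) (Y, counit_of Y, \<I>\<^bsub>cofree\<^esub>)"
      by (simp add: tensor_del_def) (simp add: cof_tensor_def tensor_del_def)
  next
    show "(\<I>\<^bsub>cofree\<^esub>, counit_of \<I>\<^bsub>cofree\<^esub>, \<I>\<^bsub>cofree\<^esub>) = \<one>\<^bsub>cofree\<^esub> \<I>\<^bsub>cofree\<^esub>"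
      by (simp add: cof_unit_def)
    show "(\<I>\<^bsub>cofree\<^esub>, comult_of \<I>\<^bsub>cofree\<^esub>, \<I>\<^bsub>cofree\<^esub> \<odot>\<^bsub>cofree\<^esub> \<I>\<^bsub>cofree\<^esub>) = unit_copy cofree"
      by (simp add: unit_copy_def cof_inverse_of) (simp add: cof_unit_def unit_copy_def)
  qed
qed

end

theorem proposition2p37:
  fixes C :: "('o, 'm, 'x) smc_scheme" and bar :: "'m \<Rightarrow> 'm"
  assumes "hom_involutive_smc C bar"
  shows "icd_category (Cof C bar)
    (\<lambda>(X, f, Y). (X, bar f, Y))
    (\<lambda>X. (X, comult_of X, X \<odot>\<^bsub>Cof C bar\<^esub> X))
    (\<lambda>X. (X, counit_of X, \<I>\<^bsub>Cof C bar\<^esub>))"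
  by (rule hom_involutive_smc.icd_category_cof[OF assms])

end
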